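(* Let $n\ge1$ and let $(\pi,V)$, $(\pi',V')$ be $R[G_n]$-modules of Whittaker type such that $(V,V')$ is not an exceptional pair. Write $\mathcal{W}=\mathcal{W}(V,\psi_R)$ and $\mathcal{W}'=\mathcal{W}(V',\psi_R^{-1})$. Then the $R$-module $\mathrm{Hom}_{R[G_n]}(\mathcal{W}\otimes_R\mathcal{W}'\otimes_R C(\mathbb{F}_q^n,R),\mathbf{1})$ of $G_n$-invariant trilinear forms is free of rank one, generated by \[I(W,W',\Phi)=\sum_{g\in N_n\backslash G_n}W(g)W'(g)\Phi(\eta g),\qquad \eta=(0,\dots,0,1).\]
   Context: Let $p$ be a prime, $q$ a power of $p$, $G_n=\mathrm{GL}_n(\mathbb{F}_q)$, $R$ a commutative Noetherian $\mathbb{Z}[\frac1p,\zeta_p]$-algebra with $0\neq1$. Fix nontrivial $\psi:(\mathbb{F}_q,+)\to\mathbb{Z}[\frac1p,\zeta_p]^\times$, $\psi_R$ its image in $R^\times$, a character of the upper unipotent group $N_n$ via $u\mapsto\psi_R(\sum_i u_{i,i+1})$. $C(\mathbb{F}_q^n,R)$ is the set of all functions $\mathbb{F}_q^n\to R$ (row vectors) with $G_n$-action $(g\cdot f)(x)=f(xg)$; $G_n$ acts diagonally on the tensor product, and on Whittaker models by right translation. $P_n$ is the mirabolic subgroup (last row $(0,\dots,0,1)$), $U_n=\{\begin{psmallmatrix}I_{n-1}&y\\0&1\end{psmallmatrix}\}$ with $\psi_R$ evaluated at $y_{n-1}$. For an $R[P_n]$-module $V$: $\Phi^-(V)=V/\langle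 uv-\psi_R(u)v\rangle_{u\in U_n}$ (an $R[P_{n-1}]$-module), $\Psi^-(V)=V/\langle uv-v\rangle_{u\in U_n}$ (an $R[G_{n-1}]$-module), $V^{(k)}=\Psi^-(\Phi^-)^{k-1}(V)$ for $1\le k\le n$; $V^{(n)}$ is the $(N_n,\psi_R)$-coinvariants. $V$ is of Whittaker type if $V^{(n)}$ is free of rank one; a generator $\lambda$ of $\mathrm{Hom}_R(V^{(n)},R)$ gives $V\to\mathrm{Ind}_{N_n}^{G_n}\psi_R$, $v\mapsto(g\mapsto\lambda(\overline{gv}))$, with image the Whittaker model $\mathcal{W}(V,\psi_R)$; similarly with $\psi_R^{-1}$. $(V,V')$ is an exceptional pair if for some $t\in\{1,\dots,n\}$ there is a nonzero $G_t$-invariant $R$-bilinear form on $\mathcal{W}(V,\psi_R)^{(n-t)}\times\mathcal{W}(V',\psi_R^{-1})^{(n-t)}$ (the latter derivative with respect to $\psi_R^{-1}$). *)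

theory Defs
  imports "Jordan_Normal_Form.Determinant" "HOL-Library.Function_Algebras"
begin

definition noetherian_ring :: "'r::comm_ring_1 itself \<Rightarrow> bool" where
  "noetherian_ring _ \<longleftrightarrow>
     (\<forall>I::'r set. Modules.module.subspace (*) I \<longrightarrow> (\<exists>F. finite F \<and> I = Modules.module.span (*) F))"

text \<open>Structure of a Z[1/p,zeta_p]-algebra on R: p invertible and an image zeta of zeta_p,
  i.e. a root of the p-th cyclotomic polynomial 1 + x + ... + x^(p-1).\<close>
definition zp_algebra :: "nat \<Rightarrow> 'r::comm_ring_1 \<Rightarrow> bool" where
  "zp_algebra p zeta \<longleftrightarrow> (\<exists>x::'r. of_nat p * x = 1) \<and> (\<Sum>i<p. zeta ^ i) = 0"

text \<open>A nontrivial additive character of F_q with values in mu_p is zeta_p^(chi a) for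
  a nontrivial additive map chi : F_q -> Z/pZ (represented by nat modulo p).\<close>
definition nontriv_additive_modp :: "nat \<Rightarrow> ('k::field \<Rightarrow> nat) \<Rightarrow> bool" where
  "nontriv_additive_modp p chi \<longleftrightarrow>
     (\<forall>a b. chi (a + b) mod p = (chi a + chi b) mod p) \<and> (\<exists>a. chi a mod p \<noteq> 0)"

definition psiR :: "'r::comm_ring_1 \<Rightarrow> ('k \<Rightarrow> nat) \<Rightarrow> 'k \<Rightarrow> 'r" where
  "psiR zeta chi a = zeta ^ chi a"

definition GL :: "nat \<Rightarrow> 'k::field mat set" where
  "GL n = {g \<in> carrier_mat n n. det g \<noteq> 0}"

definition unip :: "nat \<Rightarrow> 'k::field mat set" where
  "unip n = {u \<in> carrier_mat n n. (\<forall>i<n. u $$ (i,i) = 1) \<and> (\<forall>i<n. \<forall>j<i. u $$ (i,j) = 0)}"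

definition psiN :: "('k::field \<Rightarrow> 'r) \<Rightarrow> nat \<Rightarrow> 'k mat \<Rightarrow> 'r" where
  "psiN psi n u = psi (\<Sum>i<n - 1. u $$ (i, Suc i))"

definition embG :: "nat \<Rightarrow> nat \<Rightarrow> 'k::field mat \<Rightarrow> 'k mat" where
  "embG n t g = mat n n (\<lambda>(i,j). if i < t \<and> j < t then g $$ (i,j) else if i = j then 1 else 0)"

text \<open>U_m = {[[I_(m-1), y],[0,1]]} embedded in G_n via diag(-, I_(n-m)).\<close>
definition Uemb :: "nat \<Rightarrow> nat \<Rightarrow> 'k::field mat set" where
  "Uemb n m = {u \<in> carrier_mat n n. \<forall>i<n. \<forall>j<n.
      (j \<noteq> m - 1 \<or> m - 1 \<le> i) \<longrightarrow> u $$ (i,j) = (if i = j then 1 else 0)}"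

definition is_rep :: "('r::comm_ring_1 \<Rightarrow> 'v::ab_group_add \<Rightarrow> 'v) \<Rightarrow> ('k::field mat \<Rightarrow> 'v \<Rightarrow> 'v)
    \<Rightarrow> nat \<Rightarrow> bool" where
  "is_rep sc act n \<longleftrightarrow> Modules.module sc \<and>
     (\<forall>g\<in>GL n. (\<forall>v w. act g (v + w) = act g v + act g w) \<and> (\<forall>r v. act g (sc r v) = sc r (act g v))) \<and>
     (\<forall>v. act (1\<^sub>m n) v = v) \<and>
     (\<forall>g\<in>GL n. \<forall>h\<in>GL n. \<forall>v. act (g * h) v = act g (act h v))"

definition coinv_sub :: "('r::comm_ring_1 \<Rightarrow> 'v::ab_group_add \<Rightarrow> 'v) \<Rightarrow> ('k::field mat \<Rightarrow> 'v \<Rightarrow> 'v)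
    \<Rightarrow> ('k \<Rightarrow> 'r) \<Rightarrow> nat \<Rightarrow> 'v set" where
  "coinv_sub sc act psi n =
     Modules.module.span sc {act u v - sc (psiN psi n u) v | u v. u \<in> unip n}"

text \<open>V^(n) = V / coinv_sub is free of rank one (with basis the class of v0).\<close>
definition whittaker_type :: "('r::comm_ring_1 \<Rightarrow> 'v::ab_group_add \<Rightarrow> 'v) \<Rightarrow> ('k::field mat \<Rightarrow> 'v \<Rightarrow> 'v)
    \<Rightarrow> ('k \<Rightarrow> 'r) \<Rightarrow> nat \<Rightarrow> bool" where
  "whittaker_type sc act psi n \<longleftrightarrow>
     (\<exists>v0. (\<forall>v. \<exists>r. v - sc r v0 \<in> coinv_sub sc act psi n) \<and>
           (\<forall>r. sc r v0 \<in> coinv_sub sc act psi n \<longrightarrow> r = 0))"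

text \<open>R-linear maps V^(n) -> R, seen as R-linear maps V -> R vanishing on coinv_sub.\<close>
definition coinv_functional :: "('r::comm_ring_1 \<Rightarrow> 'v::ab_group_add \<Rightarrow> 'v) \<Rightarrow> ('k::field mat \<Rightarrow> 'v \<Rightarrow> 'v)
    \<Rightarrow> ('k \<Rightarrow> 'r) \<Rightarrow> nat \<Rightarrow> ('v \<Rightarrow> 'r) \<Rightarrow> bool" where
  "coinv_functional sc act psi n l \<longleftrightarrow>
     (\<forall>v w. l (v + w) = l v + l w) \<and> (\<forall>r v. l (sc r v) = r * l v) \<and>
     (\<forall>v\<in>coinv_sub sc act psi n. l v = 0)"

definition whittaker_generator :: "('r::comm_ring_1 \<Rightarrow> 'v::ab_group_add \<Rightarrow> 'v) \<Rightarrow> ('k::field mat \<Rightarrow> 'v \<Rightarrow> 'v)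
    \<Rightarrow> ('k \<Rightarrow> 'r) \<Rightarrow> nat \<Rightarrow> ('v \<Rightarrow> 'r) \<Rightarrow> bool" where
  "whittaker_generator sc act psi n l \<longleftrightarrow> coinv_functional sc act psi n l \<and>
     (\<forall>m. coinv_functional sc act psi n m \<longrightarrow> (\<exists>r. \<forall>v. m v = r * l v))"

definition whittaker_model :: "('k::field mat \<Rightarrow> 'v \<Rightarrow> 'v) \<Rightarrow> nat \<Rightarrow> ('v \<Rightarrow> 'r::zero)
    \<Rightarrow> ('k mat \<Rightarrow> 'r) set" where
  "whittaker_model act n l = {(\<lambda>g. if g \<in> GL n then l (act g v) else 0) | v. True}"

definition rtrans :: "nat \<Rightarrow> 'k::field mat \<Rightarrow> ('k mat \<Rightarrow> 'r::zero) \<Rightarrow> 'k mat \<Rightarrow> 'r" where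
  "rtrans n g f = (\<lambda>x. if x \<in> GL n then f (x * g) else 0)"

definition fscale :: "'r::comm_ring_1 \<Rightarrow> ('a \<Rightarrow> 'r) \<Rightarrow> 'a \<Rightarrow> 'r" where
  "fscale r f = (\<lambda>x. r * f x)"

text \<open>For 1 <= k, the k-th derivative M^(k) = Psi^-(Phi^-)^(k-1)(M) of a G_n-module M
  (action act, scalar mult sc) is M modulo the span of deriv_gens; for k = 0 it is M.
  The i-th application of Phi^- (i = 0..k-2) divides out u v - psi(y_(m-1)) v for u in U_m,
  m = n - i (embedded into G_n); Psi^- divides out u v - v for u in U_(n-k+1).\<close>
definition deriv_gens :: "('r::comm_ring_1 \<Rightarrow> 'v::ab_group_add \<Rightarrow> 'v) \<Rightarrow> ('k::field mat \<Rightarrow> 'v \<Rightarrow> 'v)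
    \<Rightarrow> ('k \<Rightarrow> 'r) \<Rightarrow> nat \<Rightarrow> nat \<Rightarrow> 'v set \<Rightarrow> 'v set" where
  "deriv_gens sc act psi n k M =
     (if k = 0 then {} else
       (\<Union>i\<in>{..<k - 1}. {act u v - sc (psi (u $$ (n - i - 2, n - i - 1))) v | u v.
                           u \<in> Uemb n (n - i) \<and> v \<in> M})
       \<union> {act u v - v | u v. u \<in> Uemb n (n - k + 1) \<and> v \<in> M})"

definition deriv_sub :: "('r::comm_ring_1 \<Rightarrow> 'v::ab_group_add \<Rightarrow> 'v) \<Rightarrow> ('k::field mat \<Rightarrow> 'v \<Rightarrow> 'v)
    \<Rightarrow> ('k \<Rightarrow> 'r) \<Rightarrow> nat \<Rightarrow> nat \<Rightarrow> 'v set \<Rightarrow> 'v set" where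
  "deriv_sub sc act psi n k M = Modules.module.span sc (deriv_gens sc act psi n k M)"

text \<open>Nonzero G_t-invariant R-bilinear forms on W^(n-t) x W'^(n-t), as bilinear forms on
  W x W' vanishing on the defining submodules.\<close>
definition exceptional_pair :: "nat \<Rightarrow> ('k::field \<Rightarrow> 'r::comm_ring_1)
    \<Rightarrow> ('k mat \<Rightarrow> 'r) set \<Rightarrow> ('k mat \<Rightarrow> 'r) set \<Rightarrow> bool" where
  "exceptional_pair n psi W W' \<longleftrightarrow>
     (\<exists>t\<in>{1..n}. \<exists>B :: ('k mat \<Rightarrow> 'r) \<Rightarrow> ('k mat \<Rightarrow> 'r) \<Rightarrow> 'r.
        (\<forall>w1\<in>W. \<forall>w2\<in>W. \<forall>w'\<in>W'. B (w1 + w2) w' = B w1 w' + B w2 w') \<and>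
        (\<forall>r. \<forall>w\<in>W. \<forall>w'\<in>W'. B (fscale r w) w' = r * B w w') \<and>
        (\<forall>w\<in>W. \<forall>w1\<in>W'. \<forall>w2\<in>W'. B w (w1 + w2) = B w w1 + B w w2) \<and>
        (\<forall>r. \<forall>w\<in>W. \<forall>w'\<in>W'. B w (fscale r w') = r * B w w') \<and>
        (\<forall>w\<in>W \<inter> deriv_sub fscale (rtrans n) psi n (n - t) W. \<forall>w'\<in>W'. B w w' = 0) \<and>
        (\<forall>w\<in>W. \<forall>w'\<in>W' \<inter> deriv_sub fscale (rtrans n) (\<lambda>a. psi (- a)) n (n - t) W'. B w w' = 0) \<and>
        (\<forall>g\<in>GL t. \<forall>w\<in>W. \<forall>w'\<in>W'. B (rtrans n (embG n t g) w) (rtrans n (embG n t g) w') = B w w') \<and>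
        (\<exists>w\<in>W. \<exists>w'\<in>W'. B w w' \<noteq> 0))"

definition Cfun :: "nat \<Rightarrow> ('k vec \<Rightarrow> 'r::zero) set" where
  "Cfun n = {\<Phi>. \<forall>x. x \<notin> carrier_vec n \<longrightarrow> \<Phi> x = 0}"

definition row_mult :: "'k::field vec \<Rightarrow> 'k mat \<Rightarrow> 'k vec" where
  "row_mult x g = transpose_mat g *\<^sub>v x"

definition Cact :: "nat \<Rightarrow> 'k::field mat \<Rightarrow> ('k vec \<Rightarrow> 'r::zero) \<Rightarrow> 'k vec \<Rightarrow> 'r" where
  "Cact n g \<Phi> = (\<lambda>x. if x \<in> carrier_vec n then \<Phi> (row_mult x g) else 0)"

definition inv_trilinear :: "nat \<Rightarrow> ('k::field mat \<Rightarrow> 'r::comm_ring_1) set \<Rightarrow> ('k mat \<Rightarrow> 'r) set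
    \<Rightarrow> (('k mat \<Rightarrow> 'r) \<Rightarrow> ('k mat \<Rightarrow> 'r) \<Rightarrow> ('k vec \<Rightarrow> 'r) \<Rightarrow> 'r) \<Rightarrow> bool" where
  "inv_trilinear n W W' T \<longleftrightarrow>
     (\<forall>w1\<in>W. \<forall>w2\<in>W. \<forall>w'\<in>W'. \<forall>\<Phi>\<in>Cfun n. T (w1 + w2) w' \<Phi> = T w1 w' \<Phi> + T w2 w' \<Phi>) \<and>
     (\<forall>r. \<forall>w\<in>W. \<forall>w'\<in>W'. \<forall>\<Phi>\<in>Cfun n. T (fscale r w) w' \<Phi> = r * T w w' \<Phi>) \<and>
     (\<forall>w\<in>W. \<forall>w1\<in>W'. \<forall>w2\<in>W'. \<forall>\<Phi>\<in>Cfun n. T w (w1 + w2) \<Phi> = T w w1 \<Phi> + T w w2 \<Phi>) \<and>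
     (\<forall>r. \<forall>w\<in>W. \<forall>w'\<in>W'. \<forall>\<Phi>\<in>Cfun n. T w (fscale r w') \<Phi> = r * T w w' \<Phi>) \<and>
     (\<forall>w\<in>W. \<forall>w'\<in>W'. \<forall>\<Phi>1\<in>Cfun n. \<forall>\<Phi>2\<in>Cfun n. T w w' (\<Phi>1 + \<Phi>2) = T w w' \<Phi>1 + T w w' \<Phi>2) \<and>
     (\<forall>r. \<forall>w\<in>W. \<forall>w'\<in>W'. \<forall>\<Phi>\<in>Cfun n. T w w' (fscale r \<Phi>) = r * T w w' \<Phi>) \<and>
     (\<forall>g\<in>GL n. \<forall>w\<in>W. \<forall>w'\<in>W'. \<forall>\<Phi>\<in>Cfun n.
         T (rtrans n g w) (rtrans n g w') (Cact n g \<Phi>) = T w w' \<Phi>)"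

definition unip_cosets :: "nat \<Rightarrow> 'k::field mat set set" where
  "unip_cosets n = {(\<lambda>u. u * g) ` unip n | g. g \<in> GL n}"

definition zeta_integral :: "nat \<Rightarrow> ('k::field mat \<Rightarrow> 'r::comm_ring_1) \<Rightarrow> ('k mat \<Rightarrow> 'r)
    \<Rightarrow> ('k vec \<Rightarrow> 'r) \<Rightarrow> 'r" where
  "zeta_integral n W W' \<Phi> =
     (\<Sum>C\<in>unip_cosets n. let g = (SOME g. g \<in> C) in
        W g * W' g * \<Phi> (row_mult (unit_vec n (n - 1)) g))"

end

theory Submission
  imports Defs "HOL-Library.FuncSet" "HOL-Library.Cardinality" "HOL-Number_Theory.Cong"
begin

text \<open>
  Restricting an invariant trilinear form \<open>T\<close> to the indicator function of \<open>\<eta>\<close> gives a bilinear form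
  \<open>B\<close> on \<open>\<W> \<times> \<W>'\<close> invariant under the mirabolic subgroup \<open>P\<^sub>n\<close>. Since \<open>p\<close> is invertible,
  vectors can be decomposed under the column subgroups \<open>U\<^sub>n, U\<^sub>n\<^sub>-\<^sub>1, \<dots>\<close> in turn. At each stage the
  component with trivial character yields an invariant form on derivatives, hence vanishes because
  the pair is not exceptional, and the other components are conjugate to the generic one. So \<open>B\<close> is
  determined by its value on the \<open>(N\<^sub>n, \<psi>)\<close>-eigenvectors of \<open>\<W>\<close> and \<open>\<W>'\<close>, which form free
  modules of rank one, spanned by functions whose restriction to \<open>P\<^sub>n\<close> is supported on \<open>N\<^sub>n\<close>; on
  these generators the zeta integral is \<open>1\<close>. A trilinear form that vanishes on all nonzero
  indicator functions is a \<open>G\<^sub>n\<close>-invariant bilinear form times evaluation at \<open>0\<close>, and vanishes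
  by non-exceptionality again.
\<close>

text \<open>Two features of R shape the proof. It may have zero divisors, so
  \<open>psi c * r = r\<close> with \<open>psi c\<close> different from 1 gives nothing by itself;
  instead the argument of psi runs over a whole line and one sums, because the full character sum is
  0 and q is a unit. And only powers of p can be divided by, so every projection is an unnormalised
  sum over a group whose order is a power of q.

  At stage t one works with characters that are arbitrary on one column and generic on all later
  ones. If the coefficient row on that column is zero, the relations are exactly those of the
  derivative of order n - t. If it is nonzero, it is the last row of some g in G_t, and conjugation
  by diag(g, I) makes it generic. For t < n every matrix used has last row eta, so invariance under
  P_n is enough; the case t = n arises only for the indicator function of 0, whose stabiliser is all
  of G_n.\<close>

section \<open>Additive characters\<close>

text \<open>If two translates of \<open>A\<close> by multiples of \<open>x\<close> met,
  \<open>(j - i) * x\<close> would lie in \<open>A\<close> with \<open>j - i\<close> invertible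
  modulo p, and then so would \<open>x\<close>. Hence adjoining one element multiplies the size by
  exactly p.\<close>

lemma additive_subgroup_extend:
  fixes A :: "'k::{field,finite} set"
  assumes 0: "0 \<in> A" and add: "\<And>a b. a \<in> A \<Longrightarrow> b \<in> A \<Longrightarrow> a + b \<in> A" and x: "x \<notin> A"
  defines "A' \<equiv> (\<lambda>(a, i). a + of_nat i * x) ` (A \<times> {..<CHAR('k)})"
  shows "0 \<in> A'" "\<And>a b. a \<in> A' \<Longrightarrow> b \<in> A' \<Longrightarrow> a + b \<in> A'" "card A' = CHAR('k) * card A" "A \<subset> A'"
proof -
  let ?p = "CHAR('k)"
  have p: "prime ?p"
    by (rule prime_CHAR_semidom) (rule finite_imp_CHAR_pos, simp)
  have ppos: "?p > 1" using p prime_gt_1_nat by blast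
  have red: "of_nat (m mod ?p) = (of_nat m :: 'k)" for m
  proof -
    have "(of_nat m :: 'k) = of_nat (?p * (m div ?p) + m mod ?p)" by simp
    thus ?thesis by (simp only: of_nat_add of_nat_mult of_nat_CHAR)simp
  qed
  have mul: "of_nat m * a \<in> A" if "a \<in> A" for m a
    by (induction m) (use that 0 add in \<open>auto simp: algebra_simps\<close>)
  show "0 \<in> A'" unfolding A'_def using 0 ppos by (force intro!: image_eqI[of _ _ "(0,0)"])
  show "a + b \<in> A'" if ab: "a \<in> A'" "b \<in> A'" for a b
  proof -
    obtain a1 i where 1: "a1 \<in> A" "a = a1 + of_nat i * x" using ab unfolding A'_def by auto
    obtain b1 j where 2: "b1 \<in> A" "b = b1 + of_nat j * x" using ab unfolding A'_def by auto
    have "a + b = (a1 + b1) + of_nat ((i + j) mod ?p) * x" unfolding red 1 2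
      by (simp add: algebra_simps)
    thus ?thesis unfolding A'_def using add[OF 1(1) 2(1)] ppos
      by (intro image_eqI[of _ _ "(a1 + b1, (i + j) mod ?p)"]) auto
  qed
  have neg: "- a \<in> A" if "a \<in> A" for a
  proof -
    \<comment> \<open>In characteristic p the negative of an element is its (p - 1)-fold sum, so
      closure under addition suffices.\<close>
    have "(of_nat (?p - 1) :: 'k) = - 1" using ppos by (simp add: of_nat_diff)
    thus ?thesis using mul[OF that, of "?p - 1"] by simp
  qed
  have aux: False if "a \<in> A" "b \<in> A" "i < j" "j < ?p" "a + of_nat i * x = b + of_nat j * x" for a b i j
  proof -
    have e: "of_nat (j - i) * x = a + - b" using that by (simp add: of_nat_diff algebra_simps)
    have nz: "(of_nat (j - i) :: 'k) \<noteq> 0"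
      using that(3,4) by (subst of_nat_eq_0_iff_char_dvd) (auto dest!: dvd_imp_le)
    have "coprime (j - i) ?p" using p that
      by (metis coprime_commute of_nat_eq_0_iff_char_dvd nz prime_imp_coprime_nat)
    then obtain y where y: "[(j - i) * y = 1] (mod ?p)" using cong_solve_coprime_nat by (metis One_nat_def)
    hence "(of_nat ((j - i) * y) :: 'k) = 1"
      by (metis cong_def of_nat_1 red)
    hence "x = of_nat y * (of_nat (j - i) * x)" by (metis mult.commute mult.left_commute mult_1 of_nat_mult)
    also have "\<dots> \<in> A" unfolding e using that by (intro mul add neg)
    finally show False using x by simp
  qed
  have inj: "inj_on (\<lambda>(a, i). a + of_nat i * x) (A \<times> {..<?p})"
  proof (rule inj_onI, clarsimp)
    fix a i b j assume h: "a \<in> A" "i < ?p" "b \<in> A" "j < ?p" "a + of_nat i * x = b + of_nat j * x"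
    have "i = j" using aux[of a b i j] aux[of b a j i] h by (metis linorder_neqE_nat)
    thus "a = b \<and> i = j" using h by auto
  qed
  show "card A' = ?p * card A" unfolding A'_def card_image[OF inj] by (simp add: card_cartesian_product)
  have "A \<subseteq> A'"
  proof
    fix a assume "a \<in> A" thus "a \<in> A'" unfolding A'_def using ppos by (intro image_eqI[of _ _ "(a,0)"]) auto
  qed
  moreover have "x \<in> A'" unfolding A'_def using ppos 0 by (intro image_eqI[of _ _ "(0,1)"]) auto
  ultimately show "A \<subset> A'" using x by blast
qed

text \<open>R is only known to contain an inverse of p; this result carries invertibility over to q.
  The set grows from \<open>{0}\<close> to the whole field by adjoining one element at a
  time.\<close>

lemma CARD_finite_field: "\<exists>m. card (UNIV :: 'k::{field,finite} set) = CHAR('k) ^ m"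
proof -
  have "\<exists>m. CARD('k) = CHAR('k) ^ m * card A"
    if "0 \<in> A" "\<And>a b. a \<in> A \<Longrightarrow> b \<in> A \<Longrightarrow> a + b \<in> A" for A :: "'k set"
    using that
  proof (induction "card (UNIV - A)" arbitrary: A rule: less_induct)
    case less
    show ?case
    proof (cases "A = UNIV")
      case True
      thus ?thesis by (intro exI[of _ 0]) simp
    next
      case False
      then obtain x where x: "x \<notin> A" by blast
      define A' where "A' = (\<lambda>(a, i). a + of_nat i * x) ` (A \<times> {..<CHAR('k)})"
      note E = additive_subgroup_extend[OF less.prems x, folded A'_def]
      have "card (UNIV - A') < card (UNIV - A)"
        by (rule psubset_card_mono) (use E(4) in auto)
      from less.hyps[OF this E(1,2)] obtain m where "CARD('k) = CHAR('k) ^ m * card A'" by blast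
      thus ?thesis by (intro exI[of _ "Suc m"]) (simp add: E(3))
    qed
  qed
  from this[of "{0}"] show ?thesis by simp
qed

locale additive_character =
  fixes psi :: "'k::{field,finite} \<Rightarrow> 'r::comm_ring_1"
  assumes psi_add: "psi (a + b) = psi a * psi b"
    and psi_0: "psi 0 = 1"
    and sum_psi: "(\<Sum>x\<in>UNIV. psi x) = 0"
    and card_unit: "of_nat CARD('k) dvd (1::'r)"
begin

lemma psi_minus_mult [simp]: "psi (- x) * psi x = 1" "psi x * psi (- x) = 1"
  by (simp_all flip: psi_add add: psi_0)

lemma psi_sum: "finite A \<Longrightarrow> psi (\<Sum>i\<in>A. f i) = (\<Prod>i\<in>A. psi (f i))"
  by (induction A rule: finite_induct) (auto simp: psi_0 psi_add)

lemma sum_psi_mult: "(\<Sum>x\<in>UNIV. psi (x * c)) = (if c = 0 then of_nat CARD('k) else 0)"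
proof (cases "c = 0")
  case False
  have "(\<Sum>x\<in>UNIV. psi (x * c)) = (\<Sum>x\<in>UNIV. psi x)"
    by (rule sum.reindex_bij_witness[of _ "\<lambda>x. x / c" "\<lambda>x. x * c"]) (use False in auto)
  thus ?thesis using False sum_psi by simp
qed (simp add: psi_0)

text \<open>Summing the hypothesis over all \<open>x\<close> gives q times \<open>r\<close> on one
  side and a vanishing character sum on the other. This takes the place of cancelling
  \<open>psi (x * c) - 1\<close>, which may be a zero divisor.\<close>

lemma psi_fixed_zero:
  assumes "\<And>x. psi (x * c) * r = r" and "c \<noteq> 0"
  shows "r = 0"
proof -
  have "of_nat CARD('k) * r = (\<Sum>x\<in>UNIV. psi (x * c) * r)" by (simp add: assms(1))
  also have "\<dots> = 0" using assms(2) by (simp flip: sum_distrib_right add: sum_psi_mult)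
  finally have *: "of_nat CARD('k) * r = 0" .
  obtain z :: 'r where "1 = of_nat CARD('k) * z" using card_unit unfolding dvd_def by blast
  hence "r = z * (of_nat CARD('k) * r)" by (metis mult.commute mult.assoc mult_1)
  thus ?thesis using * by simp
qed

lemma additive_character_minus: "additive_character (\<lambda>a. psi (- a))"
proof
  show "(\<Sum>x\<in>UNIV. psi (- x)) = 0"
    using sum_psi_mult[of "-1"] by simp
qed (auto simp: psi_add psi_0 card_unit add.commute mult.commute simp flip: psi_add)

lemma card_power_unit: "of_nat (CARD('k) ^ m) dvd (1::'r)"
  using dvd_power_same[OF card_unit, of m] by simp

text \<open>Orthogonality of the characters of a column: the sum splits into one-variable sums, and
  a single nonzero \<open>y j\<close> makes the product vanish.\<close>

lemma sum_psi_PiE: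
  assumes "finite T"
  shows "(\<Sum>a\<in>PiE T (\<lambda>_. UNIV). psi (- (\<Sum>j\<in>T. a j * y j)))
    = (if \<forall>j\<in>T. y j = 0 then of_nat (CARD('k) ^ card T) else 0)"
proof -
  have "(\<Sum>a\<in>PiE T (\<lambda>_. UNIV). psi (- (\<Sum>j\<in>T. a j * y j)))
      = (\<Sum>a\<in>PiE T (\<lambda>_. UNIV). \<Prod>j\<in>T. psi (a j * - y j))"
    by (simp flip: psi_sum[OF assms] add: sum_negf)
  also have "\<dots> = (\<Prod>j\<in>T. \<Sum>x\<in>UNIV. psi (x * - y j))"
    by (rule prod_sum_PiE[symmetric]) (use assms in auto)
  also have "\<dots> = (\<Prod>j\<in>T. if y j = 0 then of_nat CARD('k) else 0)"
    by (simp only: sum_psi_mult neg_equal_0_iff_equal)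
  also have "\<dots> = (if \<forall>j\<in>T. y j = 0 then of_nat (CARD('k) ^ card T) else 0)"
    using assms by (auto intro!: prod_zero)
  finally show ?thesis .
qed

end

lemma additive_character_psiR:
  fixes chi :: "'k::{field,finite} \<Rightarrow> nat" and zeta :: "'r::comm_ring_1"
  assumes alg: "zp_algebra CHAR('k) zeta" and chi: "nontriv_additive_modp CHAR('k) chi"
  shows "additive_character (psiR zeta chi)"
proof -
  let ?p = "CHAR('k)"
  have p: "prime ?p"
    by (rule prime_CHAR_semidom) (rule finite_imp_CHAR_pos, simp)
  obtain z where z: "of_nat ?p * z = (1::'r)" and S: "(\<Sum>i<?p. zeta ^ i) = 0"
    using alg unfolding zp_algebra_def by auto
  have zp: "zeta ^ ?p = 1"
    using power_diff_1_eq[of zeta ?p] S by simp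
  have red: "zeta ^ (m mod ?p) = zeta ^ m" for m
  proof -
    have "zeta ^ m = zeta ^ (?p * (m div ?p) + m mod ?p)" by simp
    thus ?thesis by (simp only: power_add power_mult zp power_one mult_1)
  qed
  have add: "psiR zeta chi (a + b) = psiR zeta chi a * psiR zeta chi b" for a b
    using chi unfolding psiR_def nontriv_additive_modp_def
    by (metis red power_add)
  have "(chi 0 + chi 0) mod ?p = chi 0 mod ?p"
    using chi unfolding nontriv_additive_modp_def by (metis add_0)
  hence "[chi 0 + chi 0 = chi 0 + 0] (mod ?p)" by (simp add: cong_def)
  hence "[chi 0 = 0] (mod ?p)" by (metis cong_add_lcancel_nat)
  hence zero: "psiR zeta chi 0 = 1" unfolding psiR_def by (metis cong_def red power_0)
  obtain a0 where a0: "chi a0 mod ?p \<noteq> 0" using chi unfolding nontriv_additive_modp_def by auto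
  have mult: "psiR zeta chi (of_nat j * a) = zeta ^ (chi a * j)" for j a
    by (induction j) (auto simp: zero add algebra_simps power_add, simp add: psiR_def)
  \<comment> \<open>Multiplication by \<open>chi a0\<close>, a unit modulo p, permutes the residues,
    and exponents of \<open>zeta\<close> only matter modulo p; so this is the cyclotomic relation
    again.\<close>
  have S0: "(\<Sum>j<?p. zeta ^ (chi a0 * j)) = 0"
  proof -
    have cop: "coprime (chi a0) ?p"
      using p a0 by (metis coprime_commute dvd_imp_mod_0 prime_imp_coprime_nat)
    have inj: "inj_on (\<lambda>j. chi a0 * j mod ?p) {..<?p}"
    proof (rule inj_onI)
      fix i j assume "i \<in> {..<?p}" "j \<in> {..<?p}" "chi a0 * i mod ?p = chi a0 * j mod ?p"
      thus "i = j" using cong_mult_lcancel_nat[OF cop, of i j]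
        by (simp add: cong_def)
    qed
    have "(\<lambda>j. chi a0 * j mod ?p) ` {..<?p} = {..<?p}"
      by (rule endo_inj_surj[OF _ _ inj]) (use prime_gt_0_nat[OF p] in auto)
    hence "(\<Sum>i<?p. zeta ^ i) = (\<Sum>j<?p. zeta ^ (chi a0 * j mod ?p))"
      using sum.reindex[OF inj, of "\<lambda>i. zeta ^ i"] by simp
    thus ?thesis using S by (simp add: red)
  qed
  \<comment> \<open>Translation invariance makes \<open>s\<close> fixed under multiplication by
    every value of psi. Adding this up over the multiples of \<open>a0\<close> produces the factor
    from \<open>S0\<close>, so p times \<open>s\<close> is 0.\<close>
  define s where "s = (\<Sum>x\<in>UNIV. psiR zeta chi x)"
  have tr: "s = psiR zeta chi b * s" for b
    unfolding s_def sum_distrib_left add[symmetric]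
    by (rule sum.reindex_bij_witness[of _ "\<lambda>x. b + x" "\<lambda>x. x - b"]) auto
  have "of_nat ?p * s = (\<Sum>j<?p. psiR zeta chi (of_nat j * a0) * s)"
    using tr by simp
  also have "\<dots> = 0" by (simp add: mult S0 flip: sum_distrib_right)
  finally have "s = 0" using z by (metis mult.commute mult.left_commute mult_1 mult_zero_right)
  moreover obtain m where m: "CARD('k) = ?p ^ m" using CARD_finite_field by blast
  have "of_nat CARD('k) dvd (1::'r)"
    unfolding m of_nat_power using dvd_power_same[of "of_nat ?p" 1 m] z by (metis dvd_triv_left power_one)
  ultimately show ?thesis by unfold_locales (auto simp: add zero s_def)
qed

section \<open>Matrix groups\<close>

lemma GL_carrier: "g \<in> GL n \<Longrightarrow> g \<in> carrier_mat n n"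
  by (simp add: GL_def)

lemma GL_mult: "g \<in> GL n \<Longrightarrow> h \<in> GL n \<Longrightarrow> g * h \<in> GL n"
  by (auto simp: GL_def det_mult)

lemma GL_one: "1\<^sub>m n \<in> GL n"
  by (simp add: GL_def)

lemma GL_inverse:
  assumes "g \<in> GL n"
  obtains h where "h \<in> GL n" "g * h = 1\<^sub>m n" "h * g = 1\<^sub>m n"
proof -
  have "g \<in> Units (ring_mat TYPE('a) n ())"
    using det_non_zero_imp_unit[of g n "()"] assms by (simp add: GL_def)
  then obtain h where h: "h \<in> carrier_mat n n" "g * h = 1\<^sub>m n" "h * g = 1\<^sub>m n"
    by (auto simp: Units_def ring_mat_simps)
  moreover have "det h \<noteq> 0"
    using det_mult[OF h(1), of g] h assms by (auto simp: GL_def)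
  ultimately show ?thesis using that by (auto simp: GL_def)
qed

lemma GL_if_right_inverse:
  assumes "g \<in> carrier_mat n n" "h \<in> carrier_mat n n" "g * h = 1\<^sub>m n"
  shows "g \<in> GL n"
  using det_mult[OF assms(1,2)] assms by (auto simp: GL_def)

lemma GL_cancel_left:
  assumes "g \<in> GL n" "x \<in> carrier_mat n m" "y \<in> carrier_mat n m" "g * x = g * y"
  shows "x = y"
proof -
  obtain h where h: "h \<in> GL n" "h * g = 1\<^sub>m n" using GL_inverse[OF assms(1)] by blast
  have "h * (g * z) = z" if "z \<in> carrier_mat n m" for z
    using assoc_mult_mat[OF GL_carrier[OF h(1)] GL_carrier[OF assms(1)] that] h(2) that by simp
  thus ?thesis using assms by metis
qed

lemma GL_cancel_right:
  assumes "g \<in> GL n" "x \<in> carrier_mat m n" "y \<in> carrier_mat m n" "x * g = y * g"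
  shows "x = y"
proof -
  obtain h where h: "h \<in> GL n" "g * h = 1\<^sub>m n" using GL_inverse[OF assms(1)] by blast
  have "(z * g) * h = z" if "z \<in> carrier_mat m n" for z
    using assoc_mult_mat[OF that GL_carrier[OF assms(1)] GL_carrier[OF h(1)]] h(2) that by simp
  thus ?thesis using assms by metis
qed

lemma finite_carrier_mat: "finite (carrier_mat n m :: 'k::finite mat set)"
proof (rule finite_subset)
  show "carrier_mat n m \<subseteq> (\<lambda>f. mat n m f :: 'k mat) ` (PiE ({..<n} \<times> {..<m}) (\<lambda>_. UNIV))"
  proof
    fix A :: "'k mat" assume A: "A \<in> carrier_mat n m"
    show "A \<in> (\<lambda>f. mat n m f) ` (PiE ({..<n} \<times> {..<m}) (\<lambda>_. UNIV))"
      using A by (intro image_eqI[of _ _ "restrict (\<lambda>ij. A $$ ij) ({..<n} \<times> {..<m})"]) auto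
  qed
qed (auto intro!: finite_imageI finite_PiE)

lemma finite_carrier_vec: "finite (carrier_vec n :: 'k::finite vec set)"
proof (rule finite_subset)
  show "carrier_vec n \<subseteq> (\<lambda>f. vec n f :: 'k vec) ` (PiE {..<n} (\<lambda>_. UNIV))"
  proof
    fix v :: "'k vec" assume v: "v \<in> carrier_vec n"
    show "v \<in> (\<lambda>f. vec n f) ` (PiE {..<n} (\<lambda>_. UNIV))"
      using v by (intro image_eqI[of _ _ "restrict (\<lambda>i. v $ i) {..<n}"]) auto
  qed
qed (auto intro!: finite_imageI finite_PiE)

lemma finite_GL: "finite (GL n :: 'k::{field,finite} mat set)"
  by (rule finite_subset[OF _ finite_carrier_mat[of n n]]) (auto simp: GL_def)

section \<open>Unipotent subgroups and their characters\<close>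

lemma mult_mat_index:
  "A \<in> carrier_mat m n \<Longrightarrow> B \<in> carrier_mat n l \<Longrightarrow> i < m \<Longrightarrow> j < l \<Longrightarrow>
    (A * B) $$ (i, j) = (\<Sum>k<n. A $$ (i, k) * B $$ (k, j))"
  by (auto simp: scalar_prod_def atLeast0LessThan)

text \<open>In the notation of the derivatives, this is the product of the subgroups
  \<open>U\<^sub>n, \<dots>, U\<^sub>t\<^sub>+\<^sub>1\<close>.\<close>
definition unip_cols :: "nat \<Rightarrow> nat \<Rightarrow> 'k::field mat set" where
  "unip_cols n t = {u \<in> unip n. \<forall>i<n. \<forall>j<n. j < t \<longrightarrow> u $$ (i, j) = (if i = j then 1 else 0)}"

lemma unip_cols_0: "unip_cols n 0 = unip n"
  by (simp add: unip_cols_def)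

lemma unip_cols_1: "unip_cols n 1 = unip n"
  by (auto simp: unip_cols_def unip_def)

lemma unip_cols_top: "unip_cols n n = {1\<^sub>m n}"
  by (auto simp: unip_cols_def unip_def)

lemma unip_cols_Suc:
  assumes t: "t < n"
  shows "u \<in> unip_cols n (Suc t) \<longleftrightarrow> u \<in> unip_cols n t \<and> (\<forall>i<t. u $$ (i, t) = 0)"
proof (intro iffI conjI)
  assume u: "u \<in> unip_cols n t \<and> (\<forall>i<t. u $$ (i, t) = 0)"
  have "u $$ (i, j) = (if i = j then 1 else 0)" if "i < n" "j < Suc t" for i j
  proof (cases "j = t")
    case True
    thus ?thesis using u that by (cases i t rule: linorder_cases) (auto simp: unip_cols_def unip_def)
  next
    case False
    thus ?thesis using u that t by (auto simp: unip_cols_def)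
  qed
  thus "u \<in> unip_cols n (Suc t)" using u by (simp add: unip_cols_def)
qed (use t in \<open>auto simp: unip_cols_def\<close>)

lemma unip_cols_subset_unip: "u \<in> unip_cols n t \<Longrightarrow> u \<in> unip n"
  by (simp add: unip_cols_def)

lemma unip_carrier: "u \<in> unip n \<Longrightarrow> u \<in> carrier_mat n n"
  by (simp add: unip_def)

lemma unip_GL: "unip n \<subseteq> GL n"
proof
  fix u :: "'a mat" assume u: "u \<in> unip n"
  have "det u = prod_list (diag_mat u)"
    by (rule det_upper_triangular) (use u in \<open>auto simp: unip_def intro!: upper_triangularI\<close>)
  also have "\<dots> = 1"
    unfolding prod_list_diag_prod by (rule prod.neutral) (use u in \<open>auto simp: unip_def\<close>)
  finally show "u \<in> GL n" using u by (simp add: GL_def unip_def)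
qed

lemma unip_cols_GL: "unip_cols n t \<subseteq> GL n"
  using unip_GL unip_cols_subset_unip by blast

lemma unip_mult_index:
  assumes u: "u \<in> unip n" and v: "v \<in> unip n" and ij: "i < n" "j < n"
  shows "(u * v) $$ (i, j) = (\<Sum>k\<in>{i..j}. u $$ (i, k) * v $$ (k, j))"
  unfolding mult_mat_index[OF unip_carrier[OF u] unip_carrier[OF v] ij]
  by (rule sum.mono_neutral_right) (use u v ij in \<open>auto simp: unip_def not_le\<close>)

lemma unip_mult:
  assumes u: "u \<in> unip n" and v: "v \<in> unip n"
  shows "u * v \<in> unip n"
proof -
  have "(u * v) $$ (i, j) = (if i = j then 1 else 0)" if "i < n" "j \<le> i" for i j
    using that u v by (subst unip_mult_index[OF u v]) (auto simp: unip_def le_less)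
  thus ?thesis using u v unfolding unip_def by auto
qed

lemma unip_cols_mult:
  assumes u: "u \<in> unip_cols n t" and v: "v \<in> unip_cols n t"
  shows "u * v \<in> unip_cols n t"
proof -
  note uv = unip_cols_subset_unip[OF u] unip_cols_subset_unip[OF v]
  have "(u * v) $$ (i, j) = (if i = j then 1 else 0)" if ij: "i < n" "j < n" "j < t" for i j
  proof -
    have "(u * v) $$ (i, j) = (\<Sum>k<n. u $$ (i, k) * (if k = j then 1 else 0))"
      unfolding mult_mat_index[OF unip_carrier[OF uv(1)] unip_carrier[OF uv(2)] ij(1,2)]
      using v ij by (intro sum.cong) (auto simp: unip_cols_def)
    also have "\<dots> = u $$ (i, j)" using ij by (simp add: if_distrib cong: if_cong)
    finally show ?thesis using u ij by (simp add: unip_cols_def)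
  qed
  thus ?thesis using unip_mult[OF uv] by (simp add: unip_cols_def)
qed

lemma one_unip_cols: "1\<^sub>m n \<in> unip_cols n t"
  by (auto simp: unip_cols_def unip_def)

lemma finite_unip_cols: "finite (unip_cols n t :: 'k::{field,finite} mat set)"
  using finite_subset[OF unip_cols_GL finite_GL] .

text \<open>The free entries sit at the positions in \<open>S\<close>, so the order is a power of q
  and hence a unit in R. That is what allows averaging over these groups.\<close>

lemma card_unip_cols: "\<exists>m. card (unip_cols n t :: 'k::{field,finite} mat set) = CARD('k) ^ m"
proof -
  define S where "S = {(i, j). i < j \<and> j < n \<and> t \<le> j}"
  have S: "finite S" by (rule finite_subset[of _ "{..<n} \<times> {..<n}"]) (auto simp: S_def)
  have "bij_betw (\<lambda>f. mat n n (\<lambda>(i, j). if i = j then 1 else if (i, j) \<in> S then f (i, j) else 0))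
    (PiE S (\<lambda>_. UNIV)) (unip_cols n t :: 'k mat set)"
  proof (rule bij_betw_byWitness[where f' = "\<lambda>u. restrict (\<lambda>ij. u $$ ij) S"], goal_cases)
    case 1
    thus ?case by (auto intro!: ext simp: S_def PiE_def extensional_def)
  next
    case 2
    thus ?case by (auto intro!: eq_matI simp: S_def unip_cols_def unip_def not_less not_le)
  next
    case 3
    thus ?case by (auto simp: unip_cols_def unip_def S_def)
  next
    case 4
    thus ?case by auto
  qed
  hence "card (unip_cols n t :: 'k mat set) = card (PiE S (\<lambda>_. UNIV :: 'k set))"
    by (simp add: bij_betw_same_card)
  also have "\<dots> = CARD('k) ^ card S" by (simp add: card_PiE S)
  finally show ?thesis by blast
qed

lemma (in additive_character) card_unip_cols_unit:
  "of_nat (card (unip_cols n t :: 'k mat set)) dvd (1::'r)"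
  using card_unip_cols[of n t, where 'k='k] card_power_unit by metis

text \<open>Starting at \<open>s\<close> keeps the superdiagonal entries in columns after
  \<open>s\<close>, which are the columns left free in \<open>unip_cols n (Suc s)\<close>. The case
  \<open>s = 0\<close> is the argument of psi in \<open>psiN\<close>.\<close>

definition superdiag :: "nat \<Rightarrow> nat \<Rightarrow> 'k::field mat \<Rightarrow> 'k" where
  "superdiag n s u = (\<Sum>i\<in>{s..<n - 1}. u $$ (i, Suc i))"

lemma superdiag_mult:
  assumes u: "u \<in> unip n" and v: "v \<in> unip n"
  shows "superdiag n s (u * v) = superdiag n s u + superdiag n s v"
proof -
  have "(u * v) $$ (i, Suc i) = u $$ (i, Suc i) + v $$ (i, Suc i)" if "i < n - 1" for i
  proof -
    have "{i..Suc i} = {i, Suc i}" by auto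
    thus ?thesis using that u v
      by (subst unip_mult_index[OF u v]) (auto simp: unip_def)
  qed
  thus ?thesis by (simp add: superdiag_def sum.distrib)
qed

text \<open>The characters whose restriction to later columns is generic; \<open>a\<close>
  parametrises the freedom on column \<open>t\<close>. For \<open>1 \<le> t\<close> and
  \<open>t < n\<close>, the unit vector at \<open>t - 1\<close> gives back
  \<open>superdiag n (t - 1)\<close>.\<close>

definition unip_char :: "nat \<Rightarrow> nat \<Rightarrow> (nat \<Rightarrow> 'k) \<Rightarrow> 'k::field mat \<Rightarrow> 'k" where
  "unip_char n t a u = (\<Sum>j<t. a j * u $$ (j, t)) + superdiag n t u"

text \<open>Column \<open>t\<close> is additive because the columns of \<open>u\<close> to its left
  are those of the identity, so only two terms of the matrix product survive.\<close>

lemma unip_char_mult: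
  assumes t: "t < n" and u: "u \<in> unip_cols n t" and v: "v \<in> unip_cols n t"
  shows "unip_char n t a (u * v) = unip_char n t a u + unip_char n t a v"
proof -
  note uv = unip_cols_subset_unip[OF u] unip_cols_subset_unip[OF v]
  have "(u * v) $$ (j, t) = u $$ (j, t) + v $$ (j, t)" if j: "j < t" for j
  proof -
    have "(u * v) $$ (j, t) = (\<Sum>k\<in>{j..t}. u $$ (j, k) * v $$ (k, t))"
      by (rule unip_mult_index[OF uv]) (use j t in auto)
    also have "\<dots> = (\<Sum>k\<in>{j, t}. u $$ (j, k) * v $$ (k, t))"
      using j t u by (intro sum.mono_neutral_right) (auto simp: unip_cols_def)
    also have "\<dots> = u $$ (j, t) + v $$ (j, t)"
      using j t uv by (simp add: unip_def)
    finally show ?thesis .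
  qed
  thus ?thesis using superdiag_mult[OF uv]
    by (simp add: unip_char_def sum.distrib algebra_simps)
qed

text \<open>Columns are counted from 0, so these matrices make up U_(t+1), that is
  \<open>Uemb n (Suc t)\<close>.\<close>

definition col_mat :: "nat \<Rightarrow> nat \<Rightarrow> (nat \<Rightarrow> 'k) \<Rightarrow> 'k::field mat" where
  "col_mat n t y = mat n n (\<lambda>(i, j). if i = j then 1 else if j = t \<and> i < t then y i else 0)"

lemma col_mat_unip_cols: "t < n \<Longrightarrow> col_mat n t y \<in> unip_cols n t"
  by (auto simp: col_mat_def unip_cols_def unip_def)

lemma superdiag_col_mat:
  assumes "t < n"
  shows "superdiag n s (col_mat n t y) = (if s < t then y (t - 1) else 0)"
proof -
  have "superdiag n s (col_mat n t y) = (\<Sum>i\<in>{s..<n - 1}. if i = t - 1 then (if s < t then y i else 0) else 0)"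
    unfolding superdiag_def by (rule sum.cong) (use assms in \<open>auto simp: col_mat_def\<close>)
  also have "\<dots> = (if s < t then y (t - 1) else 0)" using assms by (auto simp: sum.delta)
  finally show ?thesis .
qed

lemma unip_char_col_mat:
  assumes "t < n"
  shows "unip_char n t a (col_mat n t y) = (\<Sum>j<t. a j * y j)"
proof -
  have "(\<Sum>j<t. a j * col_mat n t y $$ (j, t)) = (\<Sum>j<t. a j * y j)"
    by (rule sum.cong) (use assms in \<open>auto simp: col_mat_def\<close>)
  thus ?thesis by (simp add: unip_char_def superdiag_col_mat[OF assms])
qed

lemma Uemb_eq_col_mat:
  assumes "t < n" "u \<in> Uemb n (Suc t)"
  shows "u = col_mat n t (\<lambda>i. u $$ (i, t))"
  using assms by (auto intro!: eq_matI simp: Uemb_def col_mat_def)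

lemma mult_col_mat:
  assumes t: "t < n" and g: "g \<in> carrier_mat n n" and ij: "i < n" "j < n"
  shows "(g * col_mat n t y) $$ (i, j)
    = g $$ (i, j) + (if j = t then \<Sum>k<t. g $$ (i, k) * y k else 0)"
proof -
  have "(g * col_mat n t y) $$ (i, j)
    = (\<Sum>k<n. (if k = j then g $$ (i, k) else 0) + (if k < t \<and> j = t then g $$ (i, k) * y k else 0))"
    unfolding mult_mat_index[OF g unip_carrier[OF unip_cols_subset_unip[OF col_mat_unip_cols[OF t]]] ij]
    using t ij by (intro sum.cong) (auto simp: col_mat_def)
  also have "\<dots> = g $$ (i, j) + (\<Sum>k<n. if k < t \<and> j = t then g $$ (i, k) * y k else 0)"
    using ij by (simp add: sum.distrib)
  also have "(\<Sum>k<n. if k < t \<and> j = t then g $$ (i, k) * y k else 0)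
      = (if j = t then \<Sum>k<t. g $$ (i, k) * y k else 0)"
    using t by (auto intro!: sum.mono_neutral_cong_right split: if_splits)
  finally show ?thesis .
qed

lemma col_mat_mult:
  assumes t: "t < n" and g: "g \<in> carrier_mat n n" and ij: "i < n" "j < n"
  shows "(col_mat n t y * g) $$ (i, j) = g $$ (i, j) + (if i < t then y i * g $$ (t, j) else 0)"
proof -
  have "(col_mat n t y * g) $$ (i, j)
    = (\<Sum>k<n. (if k = i then g $$ (k, j) else 0) + (if k = t then (if i < t then y i * g $$ (t, j) else 0) else 0))"
    unfolding mult_mat_index[OF unip_carrier[OF unip_cols_subset_unip[OF col_mat_unip_cols[OF t]]] g ij]
    using t ij by (intro sum.cong) (auto simp: col_mat_def)
  also have "\<dots> = g $$ (i, j) + (if i < t then y i * g $$ (t, j) else 0)"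
    using ij t by (simp add: sum.distrib)
  finally show ?thesis .
qed

subsection \<open>The embedded general linear groups\<close>

lemma embG_carrier: "embG n t g \<in> carrier_mat n n"
  by (simp add: embG_def)

lemma embG_mult_index:
  assumes t: "t \<le> n" and M: "M \<in> carrier_mat n n" and ij: "i < n" "j < n"
  shows "(embG n t g * M) $$ (i, j) = (if i < t then \<Sum>k<t. g $$ (i, k) * M $$ (k, j) else M $$ (i, j))"
proof (cases "i < t")
  case True
  have "(\<Sum>k<n. embG n t g $$ (i, k) * M $$ (k, j)) = (\<Sum>k<t. g $$ (i, k) * M $$ (k, j))"
    using True t ij by (intro sum.mono_neutral_cong_right) (auto simp: embG_def)
  thus ?thesis using True by (simp add: mult_mat_index[OF embG_carrier M ij])
next
  case False
  have "(\<Sum>k<n. embG n t g $$ (i, k) * M $$ (k, j)) = (\<Sum>k<n. if k = i then M $$ (k, j) else 0)"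
    using False t ij by (intro sum.cong) (auto simp: embG_def)
  thus ?thesis using False ij by (simp add: mult_mat_index[OF embG_carrier M ij])
qed

lemma mult_embG_index:
  assumes t: "t \<le> n" and M: "M \<in> carrier_mat n n" and ij: "i < n" "j < n"
  shows "(M * embG n t g) $$ (i, j) = (if j < t then \<Sum>k<t. M $$ (i, k) * g $$ (k, j) else M $$ (i, j))"
proof (cases "j < t")
  case True
  have "(\<Sum>k<n. M $$ (i, k) * embG n t g $$ (k, j)) = (\<Sum>k<t. M $$ (i, k) * g $$ (k, j))"
    using True t ij by (intro sum.mono_neutral_cong_right) (auto simp: embG_def)
  thus ?thesis using True by (simp add: mult_mat_index[OF M embG_carrier ij])
next
  case False
  have "(\<Sum>k<n. M $$ (i, k) * embG n t g $$ (k, j)) = (\<Sum>k<n. if k = j then M $$ (i, k) else 0)"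
    using False t ij by (intro sum.cong) (auto simp: embG_def)
  thus ?thesis using False ij by (simp add: mult_mat_index[OF M embG_carrier ij])
qed

lemma embG_inverse:
  assumes t: "t \<le> n" and g: "g \<in> carrier_mat t t" "h \<in> carrier_mat t t" and gh: "g * h = 1\<^sub>m t"
  shows "embG n t g * embG n t h = 1\<^sub>m n"
proof (rule eq_matI)
  fix i j assume "i < dim_row (1\<^sub>m n)" "j < dim_col (1\<^sub>m n)"
  hence ij: "i < n" "j < n" by auto
  have 1: "(\<Sum>k<t. g $$ (i, k) * h $$ (k, j)) = (if i = j then 1 else 0)" if "i < t" "j < t"
    using mult_mat_index[OF g that] gh that by simp
  have 2: "(\<Sum>k<t. g $$ (i, k) * embG n t h $$ (k, j)) = (\<Sum>k<t. g $$ (i, k) * h $$ (k, j))" if "i < t" "j < t"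
    using that t by (intro sum.cong) (auto simp: embG_def)
  have 3: "(\<Sum>k<t. g $$ (i, k) * embG n t h $$ (k, j)) = 0" if "\<not> j < t"
    using that t ij by (intro sum.neutral) (auto simp: embG_def)
  show "(embG n t g * embG n t h) $$ (i, j) = 1\<^sub>m n $$ (i, j)"
  proof (cases "i < t")
    case True
    thus ?thesis unfolding embG_mult_index[OF t embG_carrier ij] using ij 1 2 3
      by (cases "j < t") auto
  next
    case False
    thus ?thesis unfolding embG_mult_index[OF t embG_carrier ij] using ij by (auto simp: embG_def)
  qed
qed (auto simp: embG_def)

lemma embG_GL: "t \<le> n \<Longrightarrow> g \<in> GL t \<Longrightarrow> embG n t g \<in> GL n"
  by (metis GL_inverse GL_carrier GL_if_right_inverse embG_carrier embG_inverse)

lemma embG_last_row: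
  assumes "t < n" "j < n"
  shows "embG n t g $$ (n - 1, j) = (if j = n - 1 then 1 else 0)"
  using assms by (auto simp: embG_def)

lemma embG_self: "g \<in> carrier_mat n n \<Longrightarrow> embG n n g = g"
  by (auto simp: embG_def)

text \<open>The upper left block of \<open>u\<close> is the identity, so after conjugation it is
  \<open>h * g\<close>, again the identity. In the rows from \<open>t\<close> on nothing changes,
  and these are the only rows that \<open>superdiag n t\<close> reads.\<close>

lemma embG_conj:
  assumes t: "t < n" and g: "g \<in> carrier_mat t t" "h \<in> carrier_mat t t" and gh: "h * g = 1\<^sub>m t"
    and u: "u \<in> unip_cols n t"
  shows "embG n t h * (u * embG n t g) \<in> unip_cols n t"
    and "superdiag n t (embG n t h * (u * embG n t g)) = superdiag n t u"
proof -
  let ?Q = "embG n t g" and ?v = "embG n t h * (u * embG n t g)"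
  have uc: "u \<in> carrier_mat n n" using u by (simp add: unip_cols_def unip_def)
  have ucQ: "u * ?Q \<in> carrier_mat n n" using mult_carrier_mat[OF uc embG_carrier] .
  have tn: "t \<le> n" using t by simp
  have vc: "?v \<in> carrier_mat n n" using mult_carrier_mat[OF embG_carrier ucQ] .
  have uQ: "(u * ?Q) $$ (i, j) = (if j < t then (if i < t then g $$ (i, j) else 0) else u $$ (i, j))"
    if ij: "i < n" "j < n" for i j
  proof -
    have "(\<Sum>k<t. u $$ (i, k) * g $$ (k, j)) = (\<Sum>k<t. if k = i then g $$ (i, j) else 0)" if "j < t"
      using u t ij by (intro sum.cong) (auto simp: unip_cols_def)
    thus ?thesis by (simp add: mult_embG_index[OF tn uc ij])
  qed
  have lower: "?v $$ (i, j) = (if j < t then 0 else u $$ (i, j))" if "i < n" "j < n" "t \<le> i" for i j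
    using that by (simp add: embG_mult_index[OF tn ucQ] uQ)
  have upper: "?v $$ (i, j) = (if i = j then 1 else 0)" if ij: "i < t" "j < t" for i j
  proof -
    have "?v $$ (i, j) = (\<Sum>k<t. h $$ (i, k) * g $$ (k, j))"
      using ij t by (simp add: embG_mult_index[OF tn ucQ] uQ)
    also have "\<dots> = (if i = j then 1 else 0)"
      using mult_mat_index[OF g(2,1) ij] gh ij by simp
    finally show ?thesis .
  qed
  show "?v \<in> unip_cols n t"
    unfolding unip_cols_def unip_def
  proof (intro CollectI conjI allI impI, goal_cases)
    case (2 i)
    thus ?case using lower[of i i] upper[of i i] u by (cases "i < t") (auto simp: unip_cols_def unip_def)
  next
    case (3 i j)
    thus ?case using lower[of i j] upper[of i j] u t by (cases "i < t") (auto simp: unip_cols_def unip_def)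
  next
    case (4 i j)
    thus ?case using lower[of i j] upper[of i j] u t by (cases "i < t") (auto simp: unip_cols_def unip_def)
  qed (use vc in auto)
  show "superdiag n t ?v = superdiag n t u"
    unfolding superdiag_def by (rule sum.cong) (auto simp: lower)
qed

lemma embG_conj_swap:
  assumes t: "t \<le> n" and g: "g \<in> carrier_mat t t" "h \<in> carrier_mat t t" and gh: "g * h = 1\<^sub>m t"
    and u: "u \<in> carrier_mat n n"
  shows "embG n t g * (embG n t h * (u * embG n t g)) = u * embG n t g"
proof -
  have "embG n t g * (embG n t h * (u * embG n t g)) = (embG n t g * embG n t h) * (u * embG n t g)"
    by (rule assoc_mult_mat[OF embG_carrier embG_carrier mult_carrier_mat[OF u embG_carrier], symmetric])
  thus ?thesis using embG_inverse[OF t g gh] u embG_carrier[of n t g]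
    by (simp add: left_mult_one_mat)
qed

text \<open>With \<open>a\<close> as the last row of \<open>g\<close>, the column part of the
  character of the conjugate is an entry of diag(g, I) times that conjugate. This product equals
  \<open>u\<close> times diag(g, I), whose entry there is the superdiagonal entry of
  \<open>u\<close> just before those in \<open>superdiag n t\<close>. So the character given by
  \<open>a\<close> becomes the generic one.\<close>

lemma unip_char_embG_conj:
  assumes t: "1 \<le> t" "t < n" and g: "g \<in> carrier_mat t t" "h \<in> carrier_mat t t" and gh: "g * h = 1\<^sub>m t"
    and u: "u \<in> unip_cols n t" and a: "\<And>j. j < t \<Longrightarrow> g $$ (t - 1, j) = a j"
  shows "unip_char n t a (embG n t h * (u * embG n t g)) = superdiag n (t - 1) u"
proof -
  let ?v = "embG n t h * (u * embG n t g)"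
  have uc: "u \<in> carrier_mat n n" using u by (simp add: unip_cols_def unip_def)
  have vc: "?v \<in> carrier_mat n n" using mult_carrier_mat[OF embG_carrier mult_carrier_mat[OF uc embG_carrier]] .
  have tn: "t \<le> n" using t by simp
  have hg: "h * g = 1\<^sub>m t" using mat_mult_left_right_inverse[OF g gh] .
  have "(\<Sum>j<t. a j * ?v $$ (j, t)) = (embG n t g * ?v) $$ (t - 1, t)"
    using t a by (subst embG_mult_index[OF tn vc]) auto
  also have "\<dots> = (u * embG n t g) $$ (t - 1, t)"
    by (simp add: embG_conj_swap[OF tn g gh uc])
  also have "\<dots> = u $$ (t - 1, t)" using t by (subst mult_embG_index[OF tn uc]) auto
  finally have "unip_char n t a ?v = u $$ (t - 1, t) + superdiag n t u"
    using embG_conj(2)[OF t(2) g hg u] by (simp add: unip_char_def)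
  also have "\<dots> = superdiag n (t - 1) u"
    unfolding superdiag_def using t by (subst sum.atLeast_Suc_lessThan[of "t - 1"]) auto
  finally show ?thesis .
qed

text \<open>Needed twice: to conjugate a nonzero character of a column to the generic one, and to
  move \<open>eta\<close> to any nonzero row vector.\<close>

lemma GL_with_last_row:
  fixes a :: "nat \<Rightarrow> 'k::field"
  assumes j0: "j0 < t" "a j0 \<noteq> 0"
  obtains g where "g \<in> GL t" "\<And>j. j < t \<Longrightarrow> g $$ (t - 1, j) = a j"
proof -
  \<comment> \<open>The other rows are unit vectors avoiding column \<open>j0\<close>, which is left
    to the last row: row \<open>j0\<close> is redirected to column \<open>t - 1\<close>. A kernel
    vector then vanishes away from \<open>j0\<close>, and \<open>a j0\<close> being nonzero kills
    the remaining coordinate.\<close>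
  define s where "s i = (if i = j0 then t - 1 else i)" for i
  define g where "g = mat t t (\<lambda>(i, j). if i = t - 1 then a j else if j = s i then 1 else 0)"
  have gc: "g \<in> carrier_mat t t" by (simp add: g_def)
  have "det g \<noteq> 0"
  proof
    assume "det g = 0"
    then obtain v where v: "v \<in> carrier_vec t" "v \<noteq> 0\<^sub>v t" "g *\<^sub>v v = 0\<^sub>v t"
      using det_0_iff_vec_prod_zero_field[OF gc] by blast
    have gv: "(\<Sum>j<t. g $$ (i, j) * v $ j) = 0" if "i < t" for i
    proof -
      have "(g *\<^sub>v v) $ i = (\<Sum>j<t. g $$ (i, j) * v $ j)"
        using that v(1) gc by (auto simp: scalar_prod_def atLeast0LessThan)
      thus ?thesis using v(3) that by simp
    qed
    have vs: "v $ s i = 0" if i: "i < t - 1" for i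
    proof -
      have st: "s i < t" using i by (auto simp: s_def)
      have "(\<Sum>j<t. g $$ (i, j) * v $ j) = (\<Sum>j<t. if j = s i then v $ j else 0)"
        by (rule sum.cong) (use i in \<open>auto simp: g_def\<close>)
      thus ?thesis using gv[of i] i st by simp
    qed
    have v0: "v $ j = 0" if "j < t" "j \<noteq> j0" for j
    proof (cases "j = t - 1")
      case True
      hence "j0 < t - 1" using that j0 by simp
      thus ?thesis using vs[of j0] True by (simp add: s_def)
    next
      case False
      thus ?thesis using vs[of j] that by (simp add: s_def)
    qed
    have "(\<Sum>j<t. g $$ (t - 1, j) * v $ j) = (\<Sum>j<t. if j = j0 then a j * v $ j else 0)"
      by (rule sum.cong) (use j0 v0 in \<open>auto simp: g_def\<close>)
    hence "a j0 * v $ j0 = 0" using gv[of "t - 1"] j0 by simp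
    hence "v $ j = 0" if "j < t" for j using v0[of j] that j0 by auto
    hence "v = 0\<^sub>v t" using v(1) by auto
    thus False using v(2) by simp
  qed
  hence "g \<in> GL t" using gc by (simp add: GL_def)
  moreover have "g $$ (t - 1, j) = a j" if "j < t" for j using that by (simp add: g_def)
  ultimately show ?thesis using that by blast
qed

section \<open>Averaging over a group with respect to a character\<close>

lemma unit_mult_eq_0: "x dvd (1::'r::comm_ring_1) \<Longrightarrow> x * y = 0 \<Longrightarrow> y = 0"
  by (metis dvd_def mult.commute mult.left_commute mult_1 mult_zero_right)

text \<open>For a group \<open>G\<close> and a homomorphism \<open>lam\<close>, this is the
  projection onto the eigenspace of \<open>psi (lam u)\<close>, multiplied by the order of
  \<open>G\<close>, so that no inverse has to be chosen.\<close>

definition char_sum :: "('r::comm_ring_1 \<Rightarrow> 'v::ab_group_add \<Rightarrow> 'v) \<Rightarrow> ('k::field mat \<Rightarrow> 'v \<Rightarrow> 'v)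
    \<Rightarrow> ('k \<Rightarrow> 'r) \<Rightarrow> 'k mat set \<Rightarrow> ('k mat \<Rightarrow> 'k) \<Rightarrow> 'v \<Rightarrow> 'v" where
  "char_sum sc act psi G lam v = (\<Sum>u\<in>G. sc (psi (- lam u)) (act u v))"

text \<open>The unit law is left out, because right translation by the identity truncates functions
  to the general linear group.\<close>
locale linear_action = Modules.module sc
  for sc :: "'r::comm_ring_1 \<Rightarrow> 'v::ab_group_add \<Rightarrow> 'v" +
  fixes act :: "'k::{field,finite} mat \<Rightarrow> 'v \<Rightarrow> 'v" and n :: nat
  assumes act_add: "g \<in> GL n \<Longrightarrow> act g (v + w) = act g v + act g w"
    and act_scale: "g \<in> GL n \<Longrightarrow> act g (sc r v) = sc r (act g v)"
    and act_mult: "g \<in> GL n \<Longrightarrow> h \<in> GL n \<Longrightarrow> act (g * h) v = act g (act h v)"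
begin

lemma act_0: "g \<in> GL n \<Longrightarrow> act g 0 = 0"
  using act_scale[of g 0 0] by simp

lemma act_sum: "g \<in> GL n \<Longrightarrow> act g (\<Sum>i\<in>I. f i) = (\<Sum>i\<in>I. act g (f i))"
  by (induction I rule: infinite_finite_induct) (auto simp: act_0 act_add)

end

locale character_action = linear_action sc act n + additive_character psi
  for sc :: "'r::comm_ring_1 \<Rightarrow> 'v::ab_group_add \<Rightarrow> 'v"
    and act :: "'k::{field,finite} mat \<Rightarrow> 'v \<Rightarrow> 'v" and n and psi :: "'k \<Rightarrow> 'r" +
  fixes G :: "'k mat set" and lam :: "'k mat \<Rightarrow> 'k"
  assumes G_GL: "G \<subseteq> GL n"
    and G_mult: "u \<in> G \<Longrightarrow> v \<in> G \<Longrightarrow> u * v \<in> G"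
    and lam_mult: "u \<in> G \<Longrightarrow> v \<in> G \<Longrightarrow> lam (u * v) = lam u + lam v"
begin

abbreviation "csum \<equiv> char_sum sc act psi G lam"

lemma G_finite: "finite G"
  using finite_subset[OF G_GL finite_GL] .

text \<open>An injective map of a finite set into itself is onto, so closure under products already
  makes \<open>G\<close> behave as a group; closure under inverses never has to be shown.\<close>

lemma left_mult_bij:
  assumes "v \<in> G" shows "bij_betw (\<lambda>u. v * u) G G"
proof -
  have inj: "inj_on (\<lambda>u. v * u) G"
    using assms G_GL by (intro inj_onI) (meson GL_cancel_left GL_carrier subsetD)
  moreover have "(\<lambda>u. v * u) ` G = G"
    by (rule endo_inj_surj[OF G_finite _ inj]) (use assms G_mult in auto)
  ultimately show ?thesis by (simp add: bij_betw_def)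
qed

lemma right_mult_bij:
  assumes "v \<in> G" shows "bij_betw (\<lambda>u. u * v) G G"
proof -
  have inj: "inj_on (\<lambda>u. u * v) G"
    using assms G_GL by (intro inj_onI) (meson GL_cancel_right GL_carrier subsetD)
  moreover have "(\<lambda>u. u * v) ` G = G"
    by (rule endo_inj_surj[OF G_finite _ inj]) (use assms G_mult in auto)
  ultimately show ?thesis by (simp add: bij_betw_def)
qed

lemma psi_shift: "psi (- lam u) = psi (lam v) * psi (- (lam u + lam v))"
  by (simp flip: psi_add)

lemma act_csum:
  assumes v: "v \<in> G"
  shows "act v (csum x) = sc (psi (lam v)) (csum x)"
proof -
  have "act v (csum x) = (\<Sum>u\<in>G. sc (psi (- lam u)) (act (v * u) x))"
    unfolding char_sum_def using v G_GL by (subst act_sum) (auto simp: act_scale act_mult subset_iff)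
  also have "\<dots> = (\<Sum>u\<in>G. sc (psi (lam v)) (sc (psi (- lam (v * u))) (act (v * u) x)))"
    by (rule sum.cong) (use v psi_shift[of _ v] in \<open>auto simp: lam_mult add.commute\<close>)
  also have "\<dots> = (\<Sum>u\<in>G. sc (psi (lam v)) (sc (psi (- lam u)) (act u x)))"
    by (rule sum.reindex_bij_betw[OF left_mult_bij[OF v]])
  finally show ?thesis by (simp add: char_sum_def scale_sum_right)
qed

text \<open>Where \<open>act_csum\<close> concerns the values of the sum, this concerns its kernel:
  the sum kills every \<open>act v x - sc (psi (lam v)) x\<close> and so factors through
  coinvariants. Derivatives and Whittaker quotients are both reached in this way.\<close>

lemma csum_act:
  assumes v: "v \<in> G"
  shows "csum (act v x) = sc (psi (lam v)) (csum x)"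
proof -
  have "csum (act v x) = (\<Sum>u\<in>G. sc (psi (- lam u)) (act (u * v) x))"
    unfolding char_sum_def using v G_GL by (intro sum.cong) (auto simp: act_mult subset_iff)
  also have "\<dots> = (\<Sum>u\<in>G. sc (psi (lam v)) (sc (psi (- lam (u * v))) (act (u * v) x)))"
    by (rule sum.cong) (use v psi_shift[of _ v] in \<open>auto simp: lam_mult\<close>)
  also have "\<dots> = (\<Sum>u\<in>G. sc (psi (lam v)) (sc (psi (- lam u)) (act u x)))"
    by (rule sum.reindex_bij_betw[OF right_mult_bij[OF v]])
  finally show ?thesis by (simp add: char_sum_def scale_sum_right)
qed

lemma csum_add: "csum (x + y) = csum x + csum y"
  unfolding char_sum_def sum.distrib[symmetric]
  by (rule sum.cong) (use G_GL in \<open>auto simp: act_add scale_right_distrib subset_iff\<close>)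

lemma csum_scale: "csum (sc r x) = sc r (csum x)"
  unfolding char_sum_def scale_sum_right
  by (rule sum.cong) (use G_GL in \<open>auto simp: act_scale subset_iff mult.commute\<close>)

lemma csum_0: "csum 0 = 0"
  using csum_scale[of 0 0] by simp

lemma csum_diff: "csum (x - y) = csum x - csum y"
  using csum_add[of "x - y" y] by simp

lemma csum_eigen:
  assumes "\<And>u. u \<in> G \<Longrightarrow> act u x = sc (psi (lam u)) x"
  shows "csum x = sc (of_nat (card G)) x"
proof -
  have "csum x = (\<Sum>u\<in>G. sc 1 x)"
    unfolding char_sum_def by (rule sum.cong) (auto simp: assms)
  also have "\<dots> = sc (\<Sum>u\<in>G. 1) x" by (simp only: scale_sum_left)
  finally show ?thesis by simp
qed

lemma csum_span_0:
  assumes "x \<in> span S" and "\<And>x. x \<in> S \<Longrightarrow> csum x = 0"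
  shows "csum x = 0"
  using assms(1)
  by (induction rule: span_induct) (auto simp: assms(2) csum_0 csum_add csum_scale subspace_def)

end

section \<open>Spaces of functions on the general linear group\<close>

lemma module_fscale: "Modules.module (fscale :: 'r::comm_ring_1 \<Rightarrow> ('a \<Rightarrow> 'r) \<Rightarrow> 'a \<Rightarrow> 'r)"
  by unfold_locales (auto simp: fscale_def fun_eq_iff algebra_simps)

interpretation rt: linear_action fscale "rtrans n :: 'k::{field,finite} mat \<Rightarrow> ('k mat \<Rightarrow> 'r::comm_ring_1) \<Rightarrow> _" n
  for n
proof -
  interpret Modules.module "fscale :: 'r \<Rightarrow> ('k mat \<Rightarrow> 'r) \<Rightarrow> _" by (rule module_fscale)
  show "linear_action fscale (rtrans n :: 'k mat \<Rightarrow> ('k mat \<Rightarrow> 'r) \<Rightarrow> _) n"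
  proof
    fix g h :: "'k mat" and v :: "'k mat \<Rightarrow> 'r"
    assume g: "g \<in> GL n" and h: "h \<in> GL n"
    have "x * (g * h) = x * g * h" if "x \<in> GL n" for x
      by (rule assoc_mult_mat[OF GL_carrier[OF that] GL_carrier[OF g] GL_carrier[OF h], symmetric])
    thus "rtrans n (g * h) v = rtrans n g (rtrans n h v)"
      using g by (auto simp: rtrans_def fun_eq_iff GL_mult)
  qed (auto simp: rtrans_def fscale_def fun_eq_iff)
qed

locale function_rep =
  fixes n :: nat and W :: "('k::{field,finite} mat \<Rightarrow> 'r::comm_ring_1) set"
  assumes W_subspace: "Modules.module.subspace fscale W"
    and W_rtrans: "g \<in> GL n \<Longrightarrow> w \<in> W \<Longrightarrow> rtrans n g w \<in> W"
    and W_off: "w \<in> W \<Longrightarrow> x \<notin> GL n \<Longrightarrow> w x = 0"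
begin

lemma W_scale: "w \<in> W \<Longrightarrow> fscale r w \<in> W"
  and W_0: "0 \<in> W"
  using W_subspace by (auto simp: rt.subspace_def)

lemma W_sum: "(\<And>i. i \<in> I \<Longrightarrow> f i \<in> W) \<Longrightarrow> (\<Sum>i\<in>I. f i) \<in> W"
  by (rule rt.subspace_sum[OF W_subspace])

lemma W_char_sum: "G \<subseteq> GL n \<Longrightarrow> w \<in> W \<Longrightarrow> char_sum fscale (rtrans n) psi G lam w \<in> W"
  unfolding char_sum_def by (intro W_sum W_scale W_rtrans) auto

lemma rtrans_1: "w \<in> W \<Longrightarrow> rtrans n (1\<^sub>m n) w = w"
  by (auto simp: rtrans_def fun_eq_iff W_off GL_def)

end

text \<open>The start \<open>t - 1\<close> makes the character cover every superdiagonal entry in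
  the columns from \<open>t\<close> on. The conditions interpolate between none at
  \<open>t = n\<close>, for functions supported on \<open>GL n\<close>, and the full Whittaker
  condition at \<open>t = 1\<close>.\<close>

definition whittaker_vector :: "('k::field \<Rightarrow> 'r::comm_ring_1) \<Rightarrow> nat \<Rightarrow> nat \<Rightarrow> ('k mat \<Rightarrow> 'r) \<Rightarrow> bool" where
  "whittaker_vector psi n t w \<longleftrightarrow>
     (\<forall>u\<in>unip_cols n t. rtrans n u w = fscale (psi (superdiag n (t - 1) u)) w)"

section \<open>Projections for the column characters, derivatives and conjugation\<close>

context additive_character
begin

lemma character_action_unip_char:
  "t < n \<Longrightarrow> character_action fscale (rtrans n) n psi (unip_cols n t) (unip_char n t a)"
  by unfold_locales (auto simp: unip_cols_mult unip_char_mult unip_cols_GL[THEN subsetD])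

abbreviation unip_proj where
  "unip_proj n t a \<equiv> char_sum fscale (rtrans n) psi (unip_cols n t) (unip_char n t a)"

text \<open>Fourier inversion on the group \<open>U\<^sub>t\<^sub>+\<^sub>1\<close>, up to an invertible factor.\<close>
lemma sum_unip_proj:
  assumes t: "t < n" and w: "whittaker_vector psi n (Suc t) w"
  shows "(\<Sum>a\<in>PiE {..<t} (\<lambda>_. UNIV). unip_proj n t a w)
    = fscale (of_nat (CARD('k) ^ t) * of_nat (card (unip_cols n (Suc t) :: 'k mat set))) w"
proof -
  let ?A = "PiE {..<t} (\<lambda>_. UNIV :: 'k set)"
  have "(\<Sum>a\<in>?A. unip_proj n t a w)
      = (\<Sum>u\<in>unip_cols n t. \<Sum>a\<in>?A. fscale (psi (- unip_char n t a u)) (rtrans n u w))"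
    unfolding char_sum_def by (rule sum.swap)
  also have "\<dots> = (\<Sum>u\<in>unip_cols n t. fscale (\<Sum>a\<in>?A. psi (- unip_char n t a u)) (rtrans n u w))"
    by (simp add: rt.scale_sum_left)
  \<comment> \<open>The sum over \<open>a\<close> retains only those \<open>u\<close> whose column
    \<open>t\<close> is trivial. They form \<open>unip_cols n (Suc t)\<close>, where
    \<open>w\<close> is an eigenvector whose eigenvalue cancels the remaining factor of the
    character.\<close>
  also have "\<dots> = (\<Sum>u\<in>unip_cols n t.
      fscale ((if u \<in> unip_cols n (Suc t) then of_nat (CARD('k) ^ t) else 0) * psi (- superdiag n t u)) (rtrans n u w))"
  proof (rule sum.cong[OF refl])
    fix u :: "'k mat" assume u: "u \<in> unip_cols n t"
    have "(\<Sum>a\<in>?A. psi (- unip_char n t a u))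
        = (\<Sum>a\<in>?A. psi (- (\<Sum>j<t. a j * u $$ (j, t))) * psi (- superdiag n t u))"
      by (rule sum.cong) (auto simp: unip_char_def simp flip: psi_add)
    also have "\<dots> = (if u \<in> unip_cols n (Suc t) then of_nat (CARD('k) ^ t) else 0) * psi (- superdiag n t u)"
      unfolding sum_distrib_right[symmetric] using u
      by (subst sum_psi_PiE) (auto simp: unip_cols_Suc[OF t])
    finally show "fscale (\<Sum>a\<in>?A. psi (- unip_char n t a u)) (rtrans n u w) =
      fscale ((if u \<in> unip_cols n (Suc t) then of_nat (CARD('k) ^ t) else 0) * psi (- superdiag n t u)) (rtrans n u w)"
      by simp
  qed
  also have "\<dots> = (\<Sum>u\<in>(unip_cols n (Suc t) :: 'k mat set). fscale (of_nat (CARD('k) ^ t)) w)"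
  proof (rule sum.mono_neutral_cong_right)
    show "unip_cols n (Suc t) \<subseteq> unip_cols n t" using unip_cols_Suc[OF t] by auto
  next
    fix u :: "'k mat" assume u: "u \<in> unip_cols n (Suc t)"
    have "rtrans n u w = fscale (psi (superdiag n t u)) w"
      using w u by (auto simp: whittaker_vector_def)
    thus "fscale ((if u \<in> unip_cols n (Suc t) then of_nat (CARD('k) ^ t) else 0) * psi (- superdiag n t u)) (rtrans n u w)
        = fscale (of_nat (CARD('k) ^ t)) w"
      using u by (simp add: mult.assoc)
  qed (auto simp: finite_unip_cols)
  also have "\<dots> = fscale (\<Sum>u\<in>(unip_cols n (Suc t) :: 'k mat set). of_nat (CARD('k) ^ t)) w"
    by (rule rt.scale_sum_left[symmetric])
  finally show ?thesis by (simp add: mult.commute)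
qed

text \<open>The applications of Phi^- impose the generic character on the columns after
  \<open>t\<close>, and the final Psi^- imposes the trivial one on column \<open>t\<close>. Together
  these are the relations killed by the sum for \<open>a = 0\<close>.\<close>

lemma unip_proj_deriv_sub:
  assumes t: "t < n" and a: "\<And>j. j < t \<Longrightarrow> a j = 0"
    and w: "w \<in> deriv_sub fscale (rtrans n) psi n (n - t) W"
  shows "unip_proj n t a w = 0"
proof -
  interpret E: character_action fscale "rtrans n" n psi "unip_cols n t" "unip_char n t a"
    by (rule character_action_unip_char[OF t])
  have a0: "unip_char n t a u = superdiag n t u" for u by (simp add: unip_char_def a)
  have gen: "unip_proj n t a x = 0" if "x \<in> deriv_gens fscale (rtrans n) psi n (n - t) W" for x
  proof -
    from that t consider
      (phi) i u v where "i < n - t - 1" "u \<in> Uemb n (n - i)"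
        "x = rtrans n u v - fscale (psi (u $$ (n - i - 2, n - i - 1))) v"
    | (psi) u v where "u \<in> Uemb n (n - (n - t) + 1)" "x = rtrans n u v - v"
      unfolding deriv_gens_def by (auto split: if_splits)
    thus ?thesis
    proof cases
      case phi
      \<comment> \<open>The 0-based column of U_(n-i). The bound on \<open>i\<close> puts it
        strictly to the right of \<open>t\<close>, in the range of
        \<open>superdiag n t\<close>.\<close>
      define m where "m = n - i - 1"
      have m: "m < n" "t < m" "n - i = Suc m" "n - i - 2 = m - 1" using phi(1) by (auto simp: m_def)
      have ucol: "u = col_mat n m (\<lambda>i. u $$ (i, m))" using Uemb_eq_col_mat[OF m(1)] phi(2) m(3) by simp
      have u: "u \<in> unip_cols n t"
        using col_mat_unip_cols[OF m(1), of "\<lambda>i. u $$ (i, m)"] m(2) ucol by (auto simp: unip_cols_def)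
      have "superdiag n t u = u $$ (m - 1, m)"
        using superdiag_col_mat[OF m(1), of t "\<lambda>i. u $$ (i, m)"] ucol m(2) by simp
      thus ?thesis using phi(3) u m
        by (simp add: E.csum_diff E.csum_act E.csum_scale a0 m_def[symmetric])
    next
      case psi
      have "n - (n - t) + 1 = Suc t" using t by simp
      hence ucol: "u = col_mat n t (\<lambda>i. u $$ (i, t))" using Uemb_eq_col_mat[OF t] psi(1) by simp
      have u: "u \<in> unip_cols n t"
        using col_mat_unip_cols[OF t, of "\<lambda>i. u $$ (i, t)"] ucol by simp
      have "superdiag n t u = 0"
        using superdiag_col_mat[OF t, of t "\<lambda>i. u $$ (i, t)"] ucol by simp
      thus ?thesis using psi(2) u by (simp add: E.csum_diff E.csum_act a0 psi_0)
    qed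
  qed
  show ?thesis
    using w unfolding deriv_sub_def by (rule E.csum_span_0) (rule gen)
qed

text \<open>Conjugation by diag(g, I) permutes \<open>unip_cols n t\<close> and preserves
  \<open>superdiag n t\<close>, which is the whole character when \<open>a = 0\<close>. This yields
  the invariance under G_t of forms on derivatives.\<close>

lemma unip_proj_embG:
  assumes t: "t < n" and a: "\<And>j. j < t \<Longrightarrow> a j = 0" and g: "g \<in> GL t"
  shows "unip_proj n t a (rtrans n (embG n t g) w) = rtrans n (embG n t g) (unip_proj n t a w)"
proof -
  obtain h where h: "h \<in> GL t" "g * h = 1\<^sub>m t" "h * g = 1\<^sub>m t" using GL_inverse[OF g] .
  note gc = GL_carrier[OF g] and hc = GL_carrier[OF h(1)]
  have tn: "t \<le> n" using t by simp
  let ?Q = "embG n t g" and ?Q' = "embG n t h"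
  have Q: "?Q \<in> GL n" "?Q' \<in> GL n" using embG_GL[OF tn] g h by auto
  note Qc = GL_carrier[OF Q(1)] GL_carrier[OF Q(2)]
  have a0: "unip_char n t a u = superdiag n t u" for u by (simp add: unip_char_def a)
  have QQ: "?Q * ?Q' = 1\<^sub>m n" "?Q' * ?Q = 1\<^sub>m n"
    using embG_inverse[OF tn gc hc h(2)] embG_inverse[OF tn hc gc h(3)] by auto
  have bij: "bij_betw (\<lambda>u. ?Q' * (u * ?Q)) (unip_cols n t) (unip_cols n t)"
  proof (rule bij_betw_byWitness[where f' = "\<lambda>u. ?Q * (u * ?Q')"])
    have *: "X * (Y * (u * X) * Y) = u"
      if "X * Y = 1\<^sub>m n" "X \<in> carrier_mat n n" "Y \<in> carrier_mat n n" "u \<in> carrier_mat n n" for X Y u :: "'k mat"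
    proof -
      have "Y * (u * X) * Y = Y * u" using that
        by (simp add: assoc_mult_mat[of _ n n _ n _ n])
      moreover have "X * (Y * u) = u" using that
        by (simp flip: assoc_mult_mat[of _ n n _ n _ n])
      ultimately show ?thesis by simp
    qed
    show "\<forall>u\<in>unip_cols n t. ?Q * (?Q' * (u * ?Q) * ?Q') = u"
      using *[OF QQ(1) Qc] by (auto dest!: unip_cols_subset_unip unip_carrier)
    show "\<forall>u\<in>unip_cols n t. ?Q' * (?Q * (u * ?Q') * ?Q) = u"
      using *[OF QQ(2) Qc(2,1)] by (auto dest!: unip_cols_subset_unip unip_carrier)
    show "(\<lambda>u. ?Q' * (u * ?Q)) ` unip_cols n t \<subseteq> unip_cols n t"
      using embG_conj(1)[OF t gc hc h(3)] by blast
    show "(\<lambda>u. ?Q * (u * ?Q')) ` unip_cols n t \<subseteq> unip_cols n t"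
      using embG_conj(1)[OF t hc gc h(2)] by blast
  qed
  have "rtrans n ?Q (unip_proj n t a w)
      = (\<Sum>v\<in>unip_cols n t. fscale (psi (- superdiag n t v)) (rtrans n (?Q * v) w))"
    unfolding char_sum_def a0 using Q
    by (subst rt.act_sum) (auto simp: rt.act_scale rt.act_mult unip_cols_GL[THEN subsetD] intro!: sum.cong)
  also have "\<dots> = (\<Sum>u\<in>unip_cols n t. fscale (psi (- superdiag n t (?Q' * (u * ?Q)))) (rtrans n (?Q * (?Q' * (u * ?Q))) w))"
    by (rule sum.reindex_bij_betw[OF bij, symmetric])
  also have "\<dots> = (\<Sum>u\<in>unip_cols n t. fscale (psi (- superdiag n t u)) (rtrans n (u * ?Q) w))"
    by (rule sum.cong) (auto simp: embG_conj(2)[OF t gc hc h(3)]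
        embG_conj_swap[OF tn gc hc h(2) unip_carrier[OF unip_cols_subset_unip]])
  also have "\<dots> = unip_proj n t a (rtrans n ?Q w)"
    unfolding char_sum_def a0 using Q
    by (intro sum.cong) (auto simp: rt.act_mult unip_cols_GL[THEN subsetD])
  finally show ?thesis by simp
qed

text \<open>Moving \<open>u\<close> past diag(g, I) turns it into a conjugate, on which the
  character given by \<open>a\<close> has the generic value of \<open>u\<close>. This is how a
  nontrivial component is handed down to level \<open>t\<close>.\<close>

lemma whittaker_vector_embG_proj:
  assumes t: "1 \<le> t" "t < n" and g: "g \<in> GL t" and a: "\<And>j. j < t \<Longrightarrow> g $$ (t - 1, j) = a j"
  shows "whittaker_vector psi n t (rtrans n (embG n t g) (unip_proj n t a w))"
  unfolding whittaker_vector_def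
proof
  fix u :: "'k mat" assume u: "u \<in> unip_cols n t"
  interpret E: character_action fscale "rtrans n" n psi "unip_cols n t" "unip_char n t a"
    by (rule character_action_unip_char[OF t(2)])
  obtain h where h: "h \<in> GL t" "g * h = 1\<^sub>m t" "h * g = 1\<^sub>m t" using GL_inverse[OF g] .
  note gc = GL_carrier[OF g] and hc = GL_carrier[OF h(1)]
  have tn: "t \<le> n" using t by simp
  let ?Q = "embG n t g" and ?x = "unip_proj n t a w"
  define v where "v = embG n t h * (u * ?Q)"
  have v: "v \<in> unip_cols n t" unfolding v_def by (rule embG_conj(1)[OF t(2) gc hc h(3) u])
  have Q: "?Q \<in> GL n" using embG_GL[OF tn g] .
  have uG: "u \<in> GL n" and vG: "v \<in> GL n" using u v unip_cols_GL by auto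
  have "rtrans n u (rtrans n ?Q ?x) = rtrans n (u * ?Q) ?x" by (rule rt.act_mult[OF uG Q, symmetric])
  also have "u * ?Q = ?Q * v"
    unfolding v_def using embG_conj_swap[OF tn gc hc h(2) GL_carrier[OF uG]] by simp
  also have "rtrans n (?Q * v) ?x = fscale (psi (unip_char n t a v)) (rtrans n ?Q ?x)"
    by (simp add: rt.act_mult[OF Q vG] E.act_csum[OF v] rt.act_scale[OF Q])
  also have "unip_char n t a v = superdiag n (t - 1) u"
    unfolding v_def by (rule unip_char_embG_conj[OF t gc hc h(2) u a])
  finally show "rtrans n u (rtrans n ?Q ?x) = fscale (psi (superdiag n (t - 1) u)) (rtrans n ?Q ?x)" .
qed

end

section \<open>Forms invariant under the mirabolic subgroup\<close>

definition bilinear_on :: "('a \<Rightarrow> 'r::comm_ring_1) set \<Rightarrow> ('b \<Rightarrow> 'r) set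
    \<Rightarrow> (('a \<Rightarrow> 'r) \<Rightarrow> ('b \<Rightarrow> 'r) \<Rightarrow> 'r) \<Rightarrow> bool" where
  "bilinear_on W W' B \<longleftrightarrow>
     (\<forall>w1\<in>W. \<forall>w2\<in>W. \<forall>w'\<in>W'. B (w1 + w2) w' = B w1 w' + B w2 w') \<and>
     (\<forall>r. \<forall>w\<in>W. \<forall>w'\<in>W'. B (fscale r w) w' = r * B w w') \<and>
     (\<forall>w\<in>W. \<forall>w1\<in>W'. \<forall>w2\<in>W'. B w (w1 + w2) = B w w1 + B w w2) \<and>
     (\<forall>r. \<forall>w\<in>W. \<forall>w'\<in>W'. B w (fscale r w') = r * B w w')"

lemma not_exceptional_form_0:
  assumes "\<not> exceptional_pair n psi W W'" and "t \<in> {1..n}" and "bilinear_on W W' B"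
    and "\<And>w w'. w \<in> W \<Longrightarrow> w \<in> deriv_sub fscale (rtrans n) psi n (n - t) W \<Longrightarrow> w' \<in> W' \<Longrightarrow> B w w' = 0"
    and "\<And>w w'. w \<in> W \<Longrightarrow> w' \<in> W' \<Longrightarrow>
           w' \<in> deriv_sub fscale (rtrans n) (\<lambda>a. psi (- a)) n (n - t) W' \<Longrightarrow> B w w' = 0"
    and "\<And>g w w'. g \<in> GL t \<Longrightarrow> w \<in> W \<Longrightarrow> w' \<in> W' \<Longrightarrow>
           B (rtrans n (embG n t g) w) (rtrans n (embG n t g) w') = B w w'"
    and "w \<in> W" "w' \<in> W'"
  shows "B w w' = 0"
proof (rule ccontr)
  assume "B w w' \<noteq> 0"
  hence "exceptional_pair n psi W W'"
    unfolding exceptional_pair_def using assms(3)[unfolded bilinear_on_def] assms(4-8)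
    by (intro bexI[OF _ assms(2)] exI[of _ B]) auto
  thus False using assms(1) by simp
qed

locale paired_reps = additive_character psi + W: function_rep n W + W': function_rep n W'
  for psi :: "'k::{field,finite} \<Rightarrow> 'r::comm_ring_1" and n W W' +
  assumes not_exceptional: "\<not> exceptional_pair n psi W W'"
begin

text \<open>The second space transforms by the inverse character; the prefix gives it its own copy
  of every projection lemma.\<close>

sublocale psi': additive_character "\<lambda>a. psi (- a)"
  by (rule additive_character_minus)

end

locale mirabolic_form = paired_reps psi n W W'
  for psi :: "'k::{field,finite} \<Rightarrow> 'r::comm_ring_1" and n W W' +
  fixes B :: "('k mat \<Rightarrow> 'r) \<Rightarrow> ('k mat \<Rightarrow> 'r) \<Rightarrow> 'r"
  assumes bilinear: "bilinear_on W W' B"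
    and B_inv: "g \<in> GL n \<Longrightarrow> (\<And>j. j < n \<Longrightarrow> g $$ (n - 1, j) = (if j = n - 1 then 1 else 0)) \<Longrightarrow>
      w \<in> W \<Longrightarrow> w' \<in> W' \<Longrightarrow> B (rtrans n g w) (rtrans n g w') = B w w'"
begin

lemma B_add_left: "w1 \<in> W \<Longrightarrow> w2 \<in> W \<Longrightarrow> w' \<in> W' \<Longrightarrow> B (w1 + w2) w' = B w1 w' + B w2 w'"
  and B_scale_left: "w \<in> W \<Longrightarrow> w' \<in> W' \<Longrightarrow> B (fscale r w) w' = r * B w w'"
  and B_add_right: "w \<in> W \<Longrightarrow> w1' \<in> W' \<Longrightarrow> w2' \<in> W' \<Longrightarrow> B w (w1' + w2') = B w w1' + B w w2'"
  and B_scale_right: "w \<in> W \<Longrightarrow> w' \<in> W' \<Longrightarrow> B w (fscale r w') = r * B w w'"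
  using bilinear by (auto simp: bilinear_on_def)

lemma B_0_left: "w' \<in> W' \<Longrightarrow> B 0 w' = 0"
  using B_scale_left[OF W.W_0, of w' 0] by simp

lemma B_0_right: "w \<in> W \<Longrightarrow> B w 0 = 0"
  using B_scale_right[OF _ W'.W_0, of w 0] by simp

lemma B_sum_left:
  "(\<And>i. i \<in> I \<Longrightarrow> f i \<in> W) \<Longrightarrow> w' \<in> W' \<Longrightarrow> B (\<Sum>i\<in>I. f i) w' = (\<Sum>i\<in>I. B (f i) w')"
  by (induction I rule: infinite_finite_induct) (auto simp: B_0_left B_add_left W.W_sum)

lemma B_sum_right:
  "(\<And>i. i \<in> I \<Longrightarrow> f i \<in> W') \<Longrightarrow> w \<in> W \<Longrightarrow> B w (\<Sum>i\<in>I. f i) = (\<Sum>i\<in>I. B w (f i))"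
  by (induction I rule: infinite_finite_induct) (auto simp: B_0_right B_add_right W'.W_sum)

lemma proj_W: "w \<in> W \<Longrightarrow> unip_proj n t a w \<in> W"
  by (rule W.W_char_sum[OF unip_cols_GL])

lemma proj_W': "w' \<in> W' \<Longrightarrow> psi'.unip_proj n t a w' \<in> W'"
  by (rule W'.W_char_sum[OF unip_cols_GL])

text \<open>Act by an element of U_(t+1) with the single entry \<open>c\<close> in row
  \<open>j\<close>. It has last row eta since \<open>t < n\<close>, so the form is unchanged, yet
  the two eigenvalues multiply it by \<open>psi (c * (a j - b j))\<close>. As \<open>c\<close> is
  arbitrary, \<open>psi_fixed_zero\<close> applies.\<close>

lemma B_proj_orthogonal:
  assumes t: "t < n" and w: "w \<in> W" "w' \<in> W'" and j: "j < t" "a j \<noteq> b j"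
  shows "B (unip_proj n t a w) (psi'.unip_proj n t b w') = 0"
proof -
  let ?x = "unip_proj n t a w" and ?y = "psi'.unip_proj n t b w'"
  interpret E: character_action fscale "rtrans n" n psi "unip_cols n t" "unip_char n t a"
    by (rule character_action_unip_char[OF t])
  interpret E': character_action fscale "rtrans n" n "\<lambda>a. psi (- a)" "unip_cols n t" "unip_char n t b"
    by (rule psi'.character_action_unip_char[OF t])
  have "psi (c * (a j - b j)) * B ?x ?y = B ?x ?y" for c
  proof -
    define v where "v = col_mat n t (\<lambda>i. if i = j then c else 0)"
    have v: "v \<in> unip_cols n t" unfolding v_def by (rule col_mat_unip_cols[OF t])
    have ch: "unip_char n t d v = c * d j" for d
      unfolding v_def unip_char_col_mat[OF t] using j by (simp add: if_distrib cong: if_cong)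
    have row: "v $$ (n - 1, k) = (if k = n - 1 then 1 else 0)" if "k < n" for k
      using t that by (auto simp: v_def col_mat_def)
    have "B ?x ?y = B (rtrans n v ?x) (rtrans n v ?y)"
      using unip_cols_GL v by (intro B_inv[symmetric] row proj_W proj_W' w) auto
    also have "\<dots> = psi (c * a j) * (psi (- (c * b j)) * B ?x ?y)"
      by (simp add: E.act_csum[OF v] E'.act_csum[OF v] ch B_scale_left B_scale_right
          proj_W proj_W' W.W_scale W'.W_scale w)
    also have "\<dots> = psi (c * (a j - b j)) * B ?x ?y"
      by (simp add: algebra_simps flip: psi_add mult.assoc)
    finally show ?thesis by simp
  qed
  thus ?thesis by (rule psi_fixed_zero) (use j in simp)
qed

text \<open>Precomposing \<open>B\<close> with both projections gives a form that vanishes on the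
  derivative relations and is invariant under G_t, because diag(g, I) lies in P_n for
  \<open>t < n\<close>. Non-exceptionality leaves only the zero form.\<close>

lemma B_proj_trivial:
  assumes t: "1 \<le> t" "t < n" and w: "w \<in> W" "w' \<in> W'" and a: "\<And>j. j < t \<Longrightarrow> a j = 0"
  shows "B (unip_proj n t a w) (psi'.unip_proj n t a w') = 0"
proof (rule not_exceptional_form_0[OF not_exceptional _ _ _ _ _ w,
      where t = t and B = "\<lambda>w w'. B (unip_proj n t a w) (psi'.unip_proj n t a w')"])
  interpret E: character_action fscale "rtrans n" n psi "unip_cols n t" "unip_char n t a"
    by (rule character_action_unip_char[OF t(2)])
  interpret E': character_action fscale "rtrans n" n "\<lambda>a. psi (- a)" "unip_cols n t" "unip_char n t a"
    by (rule psi'.character_action_unip_char[OF t(2)])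
  show "t \<in> {1..n}" using t by simp
  show "bilinear_on W W' (\<lambda>w w'. B (unip_proj n t a w) (psi'.unip_proj n t a w'))"
    unfolding bilinear_on_def
    by (auto simp: E.csum_add E.csum_scale E'.csum_add E'.csum_scale B_add_left B_add_right
        B_scale_left B_scale_right proj_W proj_W')
  fix w w' assume w: "w \<in> W" "w' \<in> W'"
  show "B (unip_proj n t a w) (psi'.unip_proj n t a w') = 0"
    if "w \<in> deriv_sub fscale (rtrans n) psi n (n - t) W"
    using unip_proj_deriv_sub[OF t(2) a that] w by (simp add: B_0_left proj_W')
  show "B (unip_proj n t a w) (psi'.unip_proj n t a w') = 0"
    if "w' \<in> deriv_sub fscale (rtrans n) (\<lambda>a. psi (- a)) n (n - t) W'"
    using psi'.unip_proj_deriv_sub[OF t(2) a that] w by (simp add: B_0_right proj_W)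
  fix g :: "'k mat" assume g: "g \<in> GL t"
  have "embG n t g \<in> GL n" using embG_GL[OF _ g] t by simp
  moreover have "unip_proj n t a (rtrans n (embG n t g) w) = rtrans n (embG n t g) (unip_proj n t a w)"
    "psi'.unip_proj n t a (rtrans n (embG n t g) w') = rtrans n (embG n t g) (psi'.unip_proj n t a w')"
    using unip_proj_embG[OF t(2) _ g] psi'.unip_proj_embG[OF t(2) _ g] a by blast+
  ultimately show "B (unip_proj n t a (rtrans n (embG n t g) w)) (psi'.unip_proj n t a (rtrans n (embG n t g) w'))
      = B (unip_proj n t a w) (psi'.unip_proj n t a w')"
    by (simp only:) (intro B_inv embG_last_row proj_W proj_W' w t)
qed

text \<open>The Fourier components along \<open>U\<^sub>t\<^sub>+\<^sub>1\<close> of two vectors pair to zero unless their characters are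
  opposite. The trivial component is a form on the derivatives; all other components are conjugate
  under \<open>G\<^sub>t\<close> to the generic one.\<close>
lemma B_vanishes_step:
  assumes t: "1 \<le> t" "t < n"
    and van: "\<And>w w'. w \<in> W \<Longrightarrow> w' \<in> W' \<Longrightarrow> whittaker_vector psi n t w \<Longrightarrow>
      whittaker_vector (\<lambda>a. psi (- a)) n t w' \<Longrightarrow> B w w' = 0"
    and w: "w \<in> W" "w' \<in> W'" "whittaker_vector psi n (Suc t) w"
      "whittaker_vector (\<lambda>a. psi (- a)) n (Suc t) w'"
  shows "B w w' = 0"
proof -
  let ?A = "PiE {..<t} (\<lambda>_. UNIV :: 'k set)"
  let ?E = "\<lambda>a. unip_proj n t a w" and ?E' = "\<lambda>a. psi'.unip_proj n t a w'"
  have comp: "B (?E a) (?E' b) = 0" if ab: "a \<in> ?A" "b \<in> ?A" for a b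
  proof (cases "a = b")
    case False
    then obtain j where "j < t" "a j \<noteq> b j" using ab by (metis PiE_ext lessThan_iff)
    thus ?thesis by (rule B_proj_orthogonal[OF t(2) w(1,2)])
  next
    case ab: True
    show ?thesis
    proof (cases "\<forall>j<t. a j = 0")
      case True
      thus ?thesis unfolding ab[symmetric] by (intro B_proj_trivial t w) auto
    next
      case False
      then obtain j where j: "j < t" "a j \<noteq> 0" by blast
      \<comment> \<open>The same \<open>g\<close> serves both sides: the second space uses the same
        row \<open>a\<close> with the inverse character.\<close>
      obtain g where g: "g \<in> GL t" "\<And>j. j < t \<Longrightarrow> g $$ (t - 1, j) = a j"
        using GL_with_last_row[of j t a] j by blast
      have Q: "embG n t g \<in> GL n" using embG_GL[OF _ g(1)] t by simp
      have "B (?E a) (?E' a) = B (rtrans n (embG n t g) (?E a)) (rtrans n (embG n t g) (?E' a))"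
        by (intro B_inv[symmetric] embG_last_row proj_W proj_W' w t Q)
      also have "\<dots> = 0"
        using whittaker_vector_embG_proj[OF t g] psi'.whittaker_vector_embG_proj[OF t g]
        by (intro van W.W_rtrans W'.W_rtrans proj_W proj_W' w Q) auto
      finally show ?thesis using ab by simp
    qed
  qed
  \<comment> \<open>The factor from Fourier inversion. Both arguments are expanded, so it occurs
    twice and has to be cancelled twice.\<close>
  let ?c = "of_nat (CARD('k) ^ t) * of_nat (card (unip_cols n (Suc t) :: 'k mat set)) :: 'r"
  have c: "?c dvd 1"
    using mult_dvd_mono[OF card_power_unit card_unip_cols_unit] by simp
  have "?c * (?c * B w w') = B (fscale ?c w) (fscale ?c w')"
    by (simp only: B_scale_left B_scale_right w W'.W_scale)
  also have "\<dots> = B (\<Sum>a\<in>?A. ?E a) (\<Sum>b\<in>?A. ?E' b)"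
    using sum_unip_proj[OF t(2) w(3)] psi'.sum_unip_proj[OF t(2) w(4)] by simp
  also have "\<dots> = (\<Sum>a\<in>?A. \<Sum>b\<in>?A. B (?E a) (?E' b))"
    by (simp add: B_sum_left B_sum_right proj_W proj_W' W'.W_sum w)
  also have "\<dots> = 0" by (intro sum.neutral ballI comp)
  finally show ?thesis using c unit_mult_eq_0 by blast
qed

text \<open>Vanishing climbs from level 1, where it is assumed, to level \<open>n\<close>, where the
  eigenvector condition holds for all elements of the two spaces.\<close>

lemma B_vanishes:
  assumes n: "1 \<le> n"
    and van: "\<And>w w'. w \<in> W \<Longrightarrow> w' \<in> W' \<Longrightarrow> whittaker_vector psi n 1 w \<Longrightarrow>
      whittaker_vector (\<lambda>a. psi (- a)) n 1 w' \<Longrightarrow> B w w' = 0"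
    and w: "w \<in> W" "w' \<in> W'"
  shows "B w w' = 0"
proof -
  have "\<forall>w\<in>W. \<forall>w'\<in>W'. whittaker_vector psi n t w \<longrightarrow> whittaker_vector (\<lambda>a. psi (- a)) n t w' \<longrightarrow> B w w' = 0"
    if "1 \<le> t" "t \<le> n" for t
    using that
  proof (induction t rule: dec_induct)
    case base
    thus ?case using van by blast
  next
    case (step t)
    show ?case
    proof (intro ballI impI)
      fix w w' assume "w \<in> W" "w' \<in> W'" "whittaker_vector psi n (Suc t) w"
        "whittaker_vector (\<lambda>a. psi (- a)) n (Suc t) w'"
      thus "B w w' = 0"
        by (intro B_vanishes_step[of t w w']) (use step in auto)
    qed
  qed
  moreover have "whittaker_vector psi n n w" "whittaker_vector (\<lambda>a. psi (- a)) n n w'"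
    using w n by (auto simp: whittaker_vector_def unip_cols_top W.rtrans_1 W'.rtrans_1
        superdiag_def psi_0 fscale_def)
  ultimately show ?thesis using w n by blast
qed

end

section \<open>Whittaker models\<close>

lemma psiN_superdiag: "psiN psi n u = psi (superdiag n 0 u)"
  by (simp add: psiN_def superdiag_def atLeast0LessThan)

lemma whittaker_vector_1:
  "whittaker_vector psi n 1 w \<longleftrightarrow> (\<forall>u\<in>unip n. rtrans n u w = fscale (psi (superdiag n 0 u)) w)"
  unfolding whittaker_vector_def unip_cols_1 by simp

section \<open>Support of Whittaker vectors\<close>

locale whittaker_space = additive_character psi + function_rep n W
  for psi :: "'k::{field,finite} \<Rightarrow> 'r::comm_ring_1" and n W +
  assumes W_equivariant: "w \<in> W \<Longrightarrow> u \<in> unip n \<Longrightarrow> x \<in> GL n \<Longrightarrow> w (u * x) = psi (superdiag n 0 u) * w x"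
begin

text \<open>Translating \<open>g\<close> on the right by a unipotent \<open>v\<close> with entry
  \<open>x\<close> at \<open>(j, t)\<close> equals translating it on the left by a unipotent
  \<open>u\<close>, whose column \<open>t\<close> is \<open>x\<close> times column \<open>j\<close>
  of \<open>g\<close>. The right and left characters of \<open>w\<close> agree for every
  \<open>x\<close> only if the entry of \<open>g\<close> in question is that of the identity, or
  \<open>w g\<close> is 0.\<close>

lemma whittaker_vector_support_row:
  assumes w: "w \<in> W" "whittaker_vector psi n 1 w" and t: "t < n"
    and g: "g \<in> GL n" "\<And>i j. i < n \<Longrightarrow> j < n \<Longrightarrow> t \<le> i \<Longrightarrow> g $$ (i, j) = (if i = j then 1 else 0)"
    and nz: "w g \<noteq> 0" and j: "j < t"
  shows "g $$ (t - 1, j) = (if j = t - 1 then 1 else 0)"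
proof (rule ccontr)
  assume ne: "g $$ (t - 1, j) \<noteq> (if j = t - 1 then 1 else 0)"
  define c where "c = g $$ (t - 1, j) - (if j = t - 1 then 1 else 0)"
  have gc: "g \<in> carrier_mat n n" by (rule GL_carrier[OF g(1)])
  have "psi (x * c) * w g = w g" for x
  proof -
    define d where "d = (if j = t - 1 then x else 0)"
    define v where "v = col_mat n t (\<lambda>i. if i = j then x else 0)"
    define u where "u = col_mat n t (\<lambda>i. g $$ (i, j) * x)"
    have u: "u \<in> unip n" and v: "v \<in> unip n"
      using col_mat_unip_cols[OF t] unip_cols_subset_unip unfolding u_def v_def by blast+
    have vc: "v \<in> carrier_mat n n" and uc: "u \<in> carrier_mat n n" using u v unip_carrier by auto
    have gv: "g * v = u * g"
    \<comment> \<open>Row \<open>t\<close> of \<open>g\<close> is a row of the identity, so both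
      products change \<open>g\<close> only in column \<open>t\<close>, by the same multiple of
      column \<open>j\<close>.\<close>
    proof (rule eq_matI)
      fix i k assume "i < dim_row (u * g)" "k < dim_col (u * g)"
      hence ik: "i < n" "k < n" using uc gc by auto
      have s: "(\<Sum>m<t. g $$ (i, m) * (if m = j then x else 0)) = g $$ (i, j) * x"
        using j by (simp add: if_distrib cong: if_cong)
      have "g $$ (i, j) = 0" if "\<not> i < t" using g(2)[of i j] that ik j by auto
      thus "(g * v) $$ (i, k) = (u * g) $$ (i, k)"
        unfolding u_def v_def mult_col_mat[OF t gc ik] col_mat_mult[OF t gc ik] s
        using g(2)[of t k] t ik by auto
    qed (use uc vc gc in auto)
    have "psi (superdiag n 0 v) * w g = rtrans n v w g"
      using w(2)[unfolded whittaker_vector_1] v by (simp add: fscale_def)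
    also have "\<dots> = w (u * g)" using g(1) by (simp add: rtrans_def gv)
    also have "\<dots> = psi (superdiag n 0 u) * w g" by (rule W_equivariant[OF w(1) u g(1)])
    finally have e: "psi d * w g = psi (g $$ (t - 1, j) * x) * w g"
      using j unfolding u_def v_def d_def superdiag_col_mat[OF t] by (simp split: if_splits)
    have "w g = psi (- d) * (psi d * w g)" by (simp flip: mult.assoc)
    also have "\<dots> = psi (- d + g $$ (t - 1, j) * x) * w g"
      unfolding e psi_add by (simp only: mult.assoc)
    also have "- d + g $$ (t - 1, j) * x = x * c"
      by (simp add: c_def d_def algebra_simps)
    finally show ?thesis by simp
  qed
  hence "w g = 0" by (rule psi_fixed_zero) (use ne in \<open>simp add: c_def\<close>)
  thus False using nz by simp
qed

text \<open>The row lemma fixes a new row up to and including the diagonal. What lies to the right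
  is cleared by a left unipotent factor, which multiplies \<open>w\<close> by a unit, and the
  induction goes on upwards. Taking \<open>t = n - 1\<close> describes the support on the mirabolic
  subgroup.\<close>

lemma whittaker_vector_support:
  assumes w: "w \<in> W" "whittaker_vector psi n 1 w" and t: "t < n"
    and g: "g \<in> GL n" "\<And>i j. i < n \<Longrightarrow> j < n \<Longrightarrow> t \<le> i \<Longrightarrow> g $$ (i, j) = (if i = j then 1 else 0)"
    and nz: "w g \<noteq> 0"
  shows "g \<in> unip n"
  using t g nz
proof (induction t arbitrary: g)
  case 0
  hence "g = 1\<^sub>m n" by (auto intro!: eq_matI dest: GL_carrier)
  thus ?case by (auto simp: unip_def)
next
  case (Suc t)
  note row = whittaker_vector_support_row[OF w Suc.prems, simplified]
  have gc: "g \<in> carrier_mat n n" by (rule GL_carrier[OF Suc.prems(2)])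
  \<comment> \<open>Subtracts multiples of the lower rows, already rows of the identity, to clear
    row \<open>t\<close> to the right of the diagonal.\<close>
  define u where "u = mat n n (\<lambda>(i, j). if i = j then 1 else if i = t \<and> t < j then - g $$ (t, j) else 0)"
  have u: "u \<in> unip n" by (auto simp: u_def unip_def)
  note uc = unip_carrier[OF u]
  have ug: "(u * g) $$ (i, j) = (if i = j then 1 else 0)" if ij: "i < n" "j < n" "t \<le> i" for i j
  proof (cases "i = t")
    case False
    have "(u * g) $$ (i, j) = (\<Sum>k<n. if k = i then g $$ (i, j) else 0)"
      unfolding mult_mat_index[OF uc gc ij(1,2)]
      by (rule sum.cong) (use False ij in \<open>auto simp: u_def\<close>)
    thus ?thesis using ij False Suc.prems(3)[of i j] by simp
  next
    case True
    have gt: "g $$ (k, j) = (if k = j then 1 else 0)" if "t < k" "k < n" for k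
      using Suc.prems(3)[of k j] that ij by simp
    have "(u * g) $$ (i, j) = (\<Sum>k<n. (if k = t then g $$ (t, j) else 0) + (if k = j then (if t < j then - g $$ (t, j) else 0) else 0))"
      unfolding mult_mat_index[OF uc gc ij(1,2)]
      by (rule sum.cong) (use True ij gt in \<open>auto simp: u_def\<close>)
    also have "\<dots> = g $$ (t, j) + (if t < j then - g $$ (t, j) else 0)"
      using ij True by (simp add: sum.distrib)
    also have "\<dots> = (if i = j then 1 else 0)"
      using row[of j] True by (auto simp: not_less le_less)
    finally show ?thesis .
  qed
  have wug: "w (u * g) = psi (superdiag n 0 u) * w g" by (rule W_equivariant[OF w(1) u Suc.prems(2)])
  have "w (u * g) \<noteq> 0"
  proof
    assume "w (u * g) = 0"
    hence "psi (- superdiag n 0 u) * (psi (superdiag n 0 u) * w g) = 0" using wug by simp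
    thus False using Suc.prems(4) by (simp flip: mult.assoc)
  qed
  hence ugN: "u * g \<in> unip n"
    using Suc.IH[of "u * g"] Suc.prems GL_mult[OF subsetD[OF unip_GL u] Suc.prems(2)] ug by simp
  interpret N: character_action fscale "rtrans n" n psi "unip n" "superdiag n 0"
    by unfold_locales (auto simp: unip_GL[THEN subsetD] unip_mult superdiag_mult)
  \<comment> \<open>Surjectivity of left multiplication on the finite group \<open>unip n\<close>
    does the work of an inverse of \<open>u\<close>.\<close>
  obtain v where v: "v \<in> unip n" "u * g = u * v"
    using N.left_mult_bij[OF u] ugN unfolding bij_betw_def by blast
  hence "g = v" using GL_cancel_left[OF subsetD[OF unip_GL u] gc unip_carrier] by blast
  thus ?case using v by simp
qed

end

section \<open>Whittaker models of modules of Whittaker type\<close>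

locale whittaker_module = additive_character psi
  for psi :: "'k::{field,finite} \<Rightarrow> 'r::comm_ring_1" +
  fixes n :: nat and sc :: "'r \<Rightarrow> 'v::ab_group_add \<Rightarrow> 'v" and act :: "'k mat \<Rightarrow> 'v \<Rightarrow> 'v" and l :: "'v \<Rightarrow> 'r"
  assumes rep: "is_rep sc act n" and wt: "whittaker_type sc act psi n"
    and gen: "whittaker_generator sc act psi n l"
begin

sublocale N: character_action sc act n psi "unip n" "superdiag n 0"
proof -
  interpret Modules.module sc using rep by (simp add: is_rep_def)
  show "character_action sc act n psi (unip n) (superdiag n 0)"
    by unfold_locales (use rep in \<open>auto simp: is_rep_def unip_mult superdiag_mult unip_GL[THEN subsetD]\<close>)
qed

lemma l_add: "l (v + w) = l v + l w"
  and l_scale: "l (sc r v) = r * l v"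
  and l_coinv: "v \<in> coinv_sub sc act psi n \<Longrightarrow> l v = 0"
  using gen by (auto simp: whittaker_generator_def coinv_functional_def)

lemma l_0: "l 0 = 0"
  using l_scale[of 0 0] by simp

lemma l_sum: "l (\<Sum>i\<in>I. f i) = (\<Sum>i\<in>I. l (f i))"
  by (induction I rule: infinite_finite_induct) (auto simp: l_0 l_add)

lemma l_act: "u \<in> unip n \<Longrightarrow> l (act u v) = psi (superdiag n 0 u) * l v"
proof -
  assume u: "u \<in> unip n"
  have "act u v - sc (psiN psi n u) v \<in> coinv_sub sc act psi n"
    unfolding coinv_sub_def by (rule N.span_base) (use u in blast)
  hence "l (act u v - sc (psiN psi n u) v) = 0" by (rule l_coinv)
  moreover have "l (act u v) = l (act u v - sc (psiN psi n u) v) + l (sc (psiN psi n u) v)"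
    by (simp flip: l_add)
  ultimately show ?thesis by (simp add: l_scale psiN_superdiag)
qed

lemma csum_coinv: "v \<in> coinv_sub sc act psi n \<Longrightarrow> N.csum v = 0"
  unfolding coinv_sub_def
  by (erule N.csum_span_0) (auto simp: N.csum_diff N.csum_act N.csum_scale psiN_superdiag)

text \<open>The coordinate \<open>m\<close> along the basis vector is itself a functional on the
  coinvariants, hence a multiple of the generator \<open>l\<close>. Since \<open>m v0 = 1\<close>,
  that multiple inverts \<open>l v0\<close>.\<close>

lemma obtain_basis:
  obtains v0 s where "\<And>v. \<exists>r. v - sc r v0 \<in> coinv_sub sc act psi n" "s * l v0 = 1"
proof -
  let ?K = "coinv_sub sc act psi n"
  have K: "N.subspace ?K" unfolding coinv_sub_def by (rule N.subspace_span)
  obtain v0 where v0: "\<And>v. \<exists>r. v - sc r v0 \<in> ?K" "\<And>r. sc r v0 \<in> ?K \<Longrightarrow> r = 0"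
    using wt unfolding whittaker_type_def by blast
  define m where "m v = (SOME r. v - sc r v0 \<in> ?K)" for v
  have m: "v - sc (m v) v0 \<in> ?K" for v unfolding m_def by (rule someI_ex[OF v0(1)])
  have m_eq: "m v = r" if "v - sc r v0 \<in> ?K" for v r
  proof -
    have "(v - sc r v0) - (v - sc (m v) v0) \<in> ?K" using N.subspace_diff[OF K that m] .
    also have "(v - sc r v0) - (v - sc (m v) v0) = sc (m v - r) v0"
      by (simp add: N.scale_left_diff_distrib)
    finally show ?thesis using v0(2) by fastforce
  qed
  have "coinv_functional sc act psi n m"
    unfolding coinv_functional_def
  proof (intro conjI allI ballI)
    fix v w
    have "v + w - sc (m v + m w) v0 = (v - sc (m v) v0) + (w - sc (m w) v0)"
      by (simp add: N.scale_left_distrib)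
    thus "m (v + w) = m v + m w" using N.subspace_add[OF K m m] by (intro m_eq) (simp only:)
  next
    fix r v
    have "sc r v - sc (r * m v) v0 = sc r (v - sc (m v) v0)"
      by (simp add: N.scale_right_diff_distrib)
    thus "m (sc r v) = r * m v" using N.subspace_scale[OF K m] by (intro m_eq) (simp only:)
  next
    fix v assume "v \<in> ?K" thus "m v = 0" by (intro m_eq) simp
  qed
  then obtain s where s: "\<And>v. m v = s * l v" using gen unfolding whittaker_generator_def by blast
  have "m v0 = 1" by (rule m_eq) (simp add: N.subspace_0[OF K])
  thus ?thesis using that[OF v0(1), of s] s by metis
qed

definition model :: "'v \<Rightarrow> 'k mat \<Rightarrow> 'r" where
  "model v = (\<lambda>g. if g \<in> GL n then l (act g v) else 0)"

lemma whittaker_model_eq: "whittaker_model act n l = range model"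
  by (auto simp: whittaker_model_def model_def)

lemma model_add: "model (v + w) = model v + model w"
  by (auto simp: model_def fun_eq_iff N.act_add l_add)

lemma model_scale: "model (sc r v) = fscale r (model v)"
  by (auto simp: model_def fun_eq_iff N.act_scale l_scale fscale_def)

lemma model_0: "model 0 = 0"
  using model_scale[of 0 0] by simp

lemma model_act: "g \<in> GL n \<Longrightarrow> model (act g v) = rtrans n g (model v)"
  by (auto simp: model_def fun_eq_iff N.act_mult rtrans_def GL_mult)

lemma model_sum: "model (\<Sum>i\<in>I. f i) = (\<Sum>i\<in>I. model (f i))"
  by (induction I rule: infinite_finite_induct) (auto simp: model_0 model_add)

lemma model_csum: "model (N.csum v) = char_sum fscale (rtrans n) psi (unip n) (superdiag n 0) (model v)"
  unfolding char_sum_def model_sum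
  by (rule sum.cong) (auto simp: model_scale model_act unip_GL[THEN subsetD])

sublocale S: whittaker_space psi n "range model"
proof
  show "rt.subspace (range model)"
    unfolding rt.subspace_def
    by (auto simp flip: model_add model_scale intro: range_eqI[of _ _ 0] simp: model_0)
  show "rtrans n g w \<in> range model" if "g \<in> GL n" "w \<in> range model" for g w
    using that by (auto simp flip: model_act)
  show "w x = 0" if "w \<in> range model" "x \<notin> GL n" for w x
    using that by (auto simp: model_def)
  show "w (u * x) = psi (superdiag n 0 u) * w x"
    if "w \<in> range model" "u \<in> unip n" "x \<in> GL n" for w u x
    using that unip_GL[of n, where 'a='k] by (auto simp: model_def GL_mult N.act_mult l_act subset_iff)
qed

text \<open>Averaging a lift of the basis vector gives an eigenvector. Conversely, averaging a
  preimage of any eigenvector sees only its class in the coinvariants, a multiple of that of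
  \<open>v0\<close>, while on the eigenvector itself averaging is multiplication by the order of the
  group.\<close>

lemma obtain_whittaker_vector:
  obtains w1 where "w1 \<in> range model" "whittaker_vector psi n 1 w1" "w1 (1\<^sub>m n) = 1"
    "\<forall>w\<in>range model. whittaker_vector psi n 1 w \<longrightarrow> (\<exists>r. w = fscale r w1)"
proof -
  obtain v0 s where v0: "\<And>v. \<exists>r. v - sc r v0 \<in> coinv_sub sc act psi n" and s: "s * l v0 = 1"
    using obtain_basis by blast
  define N where "N = (of_nat (card (unip n :: 'k mat set)) :: 'r)"
  have "N dvd 1" unfolding N_def using card_unip_cols_unit[of n 0] by (simp add: unip_cols_0)
  then obtain c where c: "N * c = 1" by (metis dvd_def)
  \<comment> \<open>At the identity the averaged vector takes the value \<open>N * l v0\<close>; the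
    factors \<open>c\<close> and \<open>s\<close> invert its two parts.\<close>
  define w1 where "w1 = fscale (s * c) (model (N.csum v0))"
  interpret F: character_action fscale "rtrans n" n psi "unip n" "superdiag n 0"
    by unfold_locales (auto simp: unip_GL[THEN subsetD] unip_mult superdiag_mult)
  have 1: "w1 \<in> range model" unfolding w1_def by (intro S.W_scale rangeI)
  have 2: "whittaker_vector psi n 1 w1"
    unfolding whittaker_vector_1 w1_def model_csum
    by (auto simp: rt.act_scale unip_GL[THEN subsetD] F.act_csum mult.commute)
  have "l (N.csum v0) = (\<Sum>u\<in>(unip n :: 'k mat set). l v0)"
    unfolding char_sum_def l_sum
    by (rule sum.cong) (auto simp: l_scale l_act simp flip: mult.assoc)
  hence lc: "l (N.csum v0) = N * l v0" by (simp add: N_def)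
  have a1: "act (1\<^sub>m n) v = v" for v using rep by (simp add: is_rep_def)
  have "w1 (1\<^sub>m n) = s * c * (N * l v0)"
    by (simp add: w1_def fscale_def model_def GL_one a1 lc)
  also have "\<dots> = (s * l v0) * (N * c)" by (simp add: algebra_simps)
  finally have 3: "w1 (1\<^sub>m n) = 1" using s c by simp
  have 4: "\<exists>r. w = fscale r w1" if w: "w \<in> range model" "whittaker_vector psi n 1 w" for w
  proof -
    obtain v where v: "w = model v" using w by blast
    obtain r where r: "v - sc r v0 \<in> coinv_sub sc act psi n" using v0 by blast
    have "N.csum v = sc r (N.csum v0)"
      using csum_coinv[OF r] by (simp add: N.csum_diff N.csum_scale)
    hence "F.csum w = fscale r (model (N.csum v0))"
      unfolding v model_csum[symmetric] by (simp add: model_scale)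
    moreover have "F.csum w = fscale N w"
      unfolding N_def by (rule F.csum_eigen) (use w(2)[unfolded whittaker_vector_1] in simp)
    ultimately have e: "fscale N w = fscale r (model (N.csum v0))" by simp
    have "w = fscale (c * N) w" using c by (simp add: fscale_def mult.commute)
    also have "\<dots> = fscale (c * r) (model (N.csum v0))"
      using e by (simp flip: rt.scale_scale)
    also have "\<dots> = fscale (s * l v0 * c * r) (model (N.csum v0))" using s by simp
    also have "\<dots> = fscale (l v0 * r) w1"
      unfolding w1_def by (simp add: algebra_simps)
    finally show ?thesis by blast
  qed
  show ?thesis using that[OF 1 2 3] 4 by simp
qed

end

section \<open>The zeta integral\<close>

lemma row_mult_carrier: "g \<in> carrier_mat n n \<Longrightarrow> row_mult x g \<in> carrier_vec n"
  by (simp add: row_mult_def mult_mat_vec_def)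

lemma row_mult_mult:
  assumes "x \<in> carrier_vec n" "g \<in> carrier_mat n n" "h \<in> carrier_mat n n"
  shows "row_mult x (g * h) = row_mult (row_mult x g) h"
  using assms by (simp add: row_mult_def transpose_mult[OF assms(2,3)] assoc_mult_mat_vec[of _ n n _ n])

lemma row_mult_one: "x \<in> carrier_vec n \<Longrightarrow> row_mult x (1\<^sub>m n) = x"
  by (simp add: row_mult_def)

lemma row_mult_zero: "g \<in> carrier_mat n n \<Longrightarrow> row_mult (0\<^sub>v n) g = 0\<^sub>v n"
  by (auto simp: row_mult_def scalar_prod_def intro!: eq_vecI)

lemma row_mult_unit:
  assumes "1 \<le> n" "g \<in> carrier_mat n n"
  shows "row_mult (unit_vec n (n - 1)) g = row g (n - 1)"
  using assms by (auto simp: row_mult_def intro!: eq_vecI)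

section \<open>Indicator functions on row vectors and sums over cosets\<close>

definition delta :: "'k vec \<Rightarrow> 'k vec \<Rightarrow> 'r::zero_neq_one" where
  "delta x = (\<lambda>y. if y = x then 1 else 0)"

lemma delta_Cfun: "x \<in> carrier_vec n \<Longrightarrow> delta x \<in> Cfun n"
  by (auto simp: delta_def Cfun_def)

lemma Cact_delta:
  assumes g: "g \<in> GL n" and x: "x \<in> carrier_vec n"
  shows "Cact n g (delta (row_mult x g)) = delta x"
proof
  fix y
  obtain h where h: "h \<in> GL n" "g * h = 1\<^sub>m n" using GL_inverse[OF g] by blast
  have inv: "row_mult (row_mult z g) h = z" if "z \<in> carrier_vec n" for z
    using row_mult_mult[OF that GL_carrier[OF g] GL_carrier[OF h(1)]] h(2) row_mult_one[OF that] by simp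
  have "row_mult y g = row_mult x g \<longleftrightarrow> y = x" if "y \<in> carrier_vec n"
    using inv[OF that] inv[OF x] by metis
  thus "Cact n g (delta (row_mult x g)) y = delta x y"
    using x by (auto simp: Cact_def delta_def)
qed

lemma sum_fun_apply: "(\<Sum>i\<in>I. f i) y = (\<Sum>i\<in>I. f i y :: 'r::comm_ring_1)"
  by (induction I rule: infinite_finite_induct) auto

lemma Cfun_expand:
  fixes f :: "'k::finite vec \<Rightarrow> 'r::comm_ring_1"
  assumes "f \<in> Cfun n"
  shows "f = (\<Sum>x\<in>carrier_vec n. fscale (f x) (delta x))"
proof
  fix y
  have "(\<Sum>x\<in>carrier_vec n. fscale (f x) (delta x)) y = (\<Sum>x\<in>carrier_vec n. if x = y then f x else 0)"
    by (simp add: sum_fun_apply fscale_def delta_def if_distrib eq_commute cong: if_cong)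
  also have "\<dots> = f y" using assms by (simp add: finite_carrier_vec Cfun_def)
  finally show "f y = (\<Sum>x\<in>carrier_vec n. fscale (f x) (delta x)) y" by simp
qed

lemma inj_on_GL_mult_right:
  assumes "g \<in> GL n" "S \<subseteq> carrier_mat m n"
  shows "inj_on (\<lambda>x. x * g) S"
proof (rule inj_onI)
  fix x y assume "x \<in> S" "y \<in> S" "x * g = y * g"
  thus "x = y" using assms(2) by (intro GL_cancel_right[OF assms(1), of x m y]) auto
qed

lemma unip_coset_eq:
  assumes u: "(u :: 'k::{field,finite} mat) \<in> unip n" and g: "g \<in> carrier_mat n n"
  shows "(\<lambda>v. v * (u * g)) ` unip n = (\<lambda>v. v * g) ` unip n"
proof -
  have inj: "inj_on (\<lambda>v. v * u) (unip n)"
    by (rule inj_on_GL_mult_right[OF subsetD[OF unip_GL u]]) (auto dest: unip_carrier)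
  have "(\<lambda>v. v * u) ` unip n = unip n"
    by (rule endo_inj_surj[OF _ _ inj])
      (use u unip_mult finite_unip_cols[of n 0] in \<open>auto simp: unip_cols_0\<close>)
  hence "(\<lambda>v. v * g) ` unip n = (\<lambda>v. v * g) ` (\<lambda>v. v * u) ` unip n" by simp
  also have "\<dots> = (\<lambda>v. v * (u * g)) ` unip n"
    unfolding image_image
    by (rule image_cong) (auto simp: assoc_mult_mat[OF unip_carrier unip_carrier[OF u] g])
  finally show ?thesis by simp
qed

text \<open>Exchanges the chosen coset representatives for a sum over the whole group. The factor is
  a unit, so identities can be checked on the group side, where translation is a reindexing.\<close>

lemma sum_GL_unip_cosets:
  fixes f :: "'k::{field,finite} mat \<Rightarrow> 'r::comm_ring_1"
  assumes inv: "\<And>u x. u \<in> unip n \<Longrightarrow> x \<in> GL n \<Longrightarrow> f (u * x) = f x"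
  shows "(\<Sum>x\<in>GL n. f x) = of_nat (card (unip n :: 'k mat set)) * (\<Sum>C\<in>unip_cosets n. f (SOME g. g \<in> C))"
proof -
  let ?c = "\<lambda>g :: 'k mat. (\<lambda>v. v * g) ` unip n"
  have one: "1\<^sub>m n \<in> (unip n :: 'k mat set)" using one_unip_cols[of n 0] by (simp add: unip_cols_0)
  have self: "g \<in> ?c g" if "g \<in> GL n" for g
    by (rule image_eqI[OF _ one]) (use GL_carrier[OF that] in simp)
  have sub: "?c g \<subseteq> GL n" if "g \<in> GL n" for g using that unip_GL[of n] by (auto intro: GL_mult)
  have Un: "\<Union>(unip_cosets n) = (GL n :: 'k mat set)"
    using self sub by (fastforce simp: unip_cosets_def)
  \<comment> \<open>A coset is determined by any of its elements, which gives disjointness and lets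
    the chosen representative stand for the original one.\<close>
  have eq: "C = ?c x" if "C \<in> unip_cosets n" "x \<in> C" for C x
  proof -
    obtain g where g: "g \<in> GL n" "C = ?c g" using \<open>C \<in> unip_cosets n\<close> by (auto simp: unip_cosets_def)
    then obtain u where "u \<in> unip n" "x = u * g" using \<open>x \<in> C\<close> by (auto simp: image_iff)
    thus ?thesis using unip_coset_eq GL_carrier[OF g(1)] g(2) by metis
  qed
  have "(\<Sum>x\<in>GL n. f x) = sum f (\<Union>(unip_cosets n))" by (simp add: Un)
  also have "\<dots> = (\<Sum>C\<in>unip_cosets n. sum f C)"
  proof (subst sum.Union_disjoint)
    show "\<forall>C\<in>unip_cosets n. finite (C :: 'k mat set)"
      using finite_unip_cols[of n 0] by (auto simp: unip_cosets_def unip_cols_0)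
    show "\<forall>A\<in>unip_cosets n. \<forall>B\<in>unip_cosets n. A \<noteq> B \<longrightarrow> A \<inter> (B :: 'k mat set) = {}"
      using eq by blast
  qed simp
  also have "\<dots> = (\<Sum>C\<in>unip_cosets n. of_nat (card (unip n :: 'k mat set)) * f (SOME g. g \<in> C))"
  proof (rule sum.cong[OF refl])
    fix C :: "'k mat set" assume C: "C \<in> unip_cosets n"
    define x where "x = (SOME g. g \<in> C)"
    have "C \<noteq> {}" using C self by (auto simp: unip_cosets_def)
    hence xC: "x \<in> C" unfolding x_def by (rule some_in_eq[THEN iffD2])
    have xG: "x \<in> GL n" using xC C Un by blast
    have inj: "inj_on (\<lambda>v. v * x) (unip n)"
      by (rule inj_on_GL_mult_right[OF xG]) (auto dest: unip_carrier)
    have "sum f C = (\<Sum>v\<in>unip n. f (v * x))"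
      unfolding eq[OF C xC] using sum.reindex[OF inj, of f] by simp
    also have "\<dots> = (\<Sum>v\<in>(unip n :: 'k mat set). f x)" by (rule sum.cong) (auto simp: inv xG)
    finally show "sum f C = of_nat (card (unip n :: 'k mat set)) * f (SOME g. g \<in> C)" by (simp add: x_def)
  qed
  finally show ?thesis by (simp add: sum_distrib_left)
qed

section \<open>Invariant trilinear forms on a pair of Whittaker spaces\<close>

locale whittaker_pair = additive_character psi + W: whittaker_space psi n W +
  W': whittaker_space "\<lambda>a. psi (- a)" n W'
  for psi :: "'k::{field,finite} \<Rightarrow> 'r::comm_ring_1" and n W W' +
  assumes n_pos: "1 \<le> n"
begin

abbreviation eta :: "'k vec" where "eta \<equiv> unit_vec n (n - 1)"

lemma row_mult_eta_unip: "u \<in> unip n \<Longrightarrow> row_mult eta u = eta"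
  using n_pos by (subst row_mult_unit) (auto simp: unip_def intro!: eq_vecI)

text \<open>The summand is constant on cosets: the two characters are inverse to each other, and
  \<open>eta\<close> is fixed by unipotent matrices.\<close>

lemma zeta_integral_GL:
  assumes "w \<in> W" "w' \<in> W'"
  shows "of_nat (card (unip n :: 'k mat set)) * zeta_integral n w w' f
    = (\<Sum>x\<in>GL n. w x * w' x * f (row_mult eta x))"
proof -
  have "w (u * x) * w' (u * x) * f (row_mult eta (u * x)) = w x * w' x * f (row_mult eta x)"
    if ux: "u \<in> unip n" "x \<in> GL n" for u x
  proof -
    have "row_mult eta (u * x) = row_mult eta x"
      using row_mult_mult[OF _ unip_carrier[OF ux(1)] GL_carrier[OF ux(2)]] row_mult_eta_unip[OF ux(1)] by simp
    moreover have "w (u * x) * w' (u * x) = (psi (superdiag n 0 u) * psi (- superdiag n 0 u)) * (w x * w' x)"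
      by (simp only: W.W_equivariant[OF assms(1) ux] W'.W_equivariant[OF assms(2) ux] mult_ac)
    ultimately show ?thesis by simp
  qed
  from sum_GL_unip_cosets[of n "\<lambda>x. w x * w' x * f (row_mult eta x)", OF this]
  show ?thesis by (simp add: zeta_integral_def Let_def)
qed

lemma card_unip_cancel:
  "of_nat (card (unip n :: 'k mat set)) * a = of_nat (card (unip n :: 'k mat set)) * (b :: 'r) \<Longrightarrow> a = b"
  using unit_mult_eq_0[OF card_unip_cols_unit[of n 0], of "a - b"]
  by (simp add: unip_cols_0 right_diff_distrib)

lemma zeta_integral_invariant:
  assumes g: "g \<in> GL n" and w: "w \<in> W" "w' \<in> W'"
  shows "zeta_integral n (rtrans n g w) (rtrans n g w') (Cact n g f) = zeta_integral n w w' f"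
proof (rule card_unip_cancel)
  let ?f = "\<lambda>x. w x * w' x * f (row_mult eta x)"
  have inj: "inj_on (\<lambda>x. x * g) (GL n)"
    by (rule inj_on_GL_mult_right[OF g]) (auto dest: GL_carrier)
  have im: "(\<lambda>x. x * g) ` GL n = GL n"
    by (rule endo_inj_surj[OF finite_GL _ inj]) (use g GL_mult in auto)
  have "of_nat (card (unip n :: 'k mat set)) * zeta_integral n (rtrans n g w) (rtrans n g w') (Cact n g f)
      = (\<Sum>x\<in>GL n. rtrans n g w x * rtrans n g w' x * Cact n g f (row_mult eta x))"
    by (rule zeta_integral_GL) (use W.W_rtrans W'.W_rtrans g w in auto)
  also have "\<dots> = (\<Sum>x\<in>GL n. ?f (x * g))"
  proof (rule sum.cong[OF refl])
    fix x :: "'k mat" assume x: "x \<in> GL n"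
    have "row_mult eta (x * g) = row_mult (row_mult eta x) g"
      by (rule row_mult_mult[OF _ GL_carrier[OF x] GL_carrier[OF g]]) simp
    thus "rtrans n g w x * rtrans n g w' x * Cact n g f (row_mult eta x) = ?f (x * g)"
      using x row_mult_carrier[OF GL_carrier[OF x]] by (simp add: rtrans_def Cact_def)
  qed
  also have "\<dots> = (\<Sum>x\<in>GL n. ?f x)"
    using sum.reindex[OF inj, of ?f] im by simp
  also have "\<dots> = of_nat (card (unip n :: 'k mat set)) * zeta_integral n w w' f"
    by (rule zeta_integral_GL[symmetric]) (use w in auto)
  finally show "of_nat (card (unip n :: 'k mat set)) * zeta_integral n (rtrans n g w) (rtrans n g w') (Cact n g f)
      = of_nat (card (unip n :: 'k mat set)) * zeta_integral n w w' f" .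
qed

lemma inv_trilinear_zeta_integral: "inv_trilinear n W W' (zeta_integral n)"
  unfolding inv_trilinear_def
proof (intro conjI ballI allI)
  show "zeta_integral n (rtrans n g w) (rtrans n g w') (Cact n g f) = zeta_integral n w w' f"
    if "g \<in> GL n" "w \<in> W" "w' \<in> W'" for g w w' f
    using that by (rule zeta_integral_invariant)
qed (simp_all add: zeta_integral_def Let_def fscale_def sum_distrib_left algebra_simps flip: sum.distrib)

text \<open>The indicator restricts the sum to matrices with last row \<open>eta\<close>, and there
  \<open>w\<close> is supported on \<open>unip n\<close>. Each unipotent element contributes 1, so
  the sum is the order of the group, which cancels.\<close>

lemma zeta_integral_whittaker_vectors:
  assumes w: "w \<in> W" "whittaker_vector psi n 1 w" "w (1\<^sub>m n) = 1"
    and w': "w' \<in> W'" "w' (1\<^sub>m n) = 1"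
  shows "zeta_integral n w w' (delta eta) = 1"
proof (rule card_unip_cancel)
  have "of_nat (card (unip n :: 'k mat set)) * zeta_integral n w w' (delta eta)
      = (\<Sum>x\<in>GL n. w x * w' x * delta eta (row_mult eta x))"
    by (rule zeta_integral_GL[OF w(1) w'(1)])
  also have "\<dots> = (\<Sum>x\<in>(unip n :: 'k mat set). 1)"
  proof (rule sum.mono_neutral_cong_right[OF finite_GL unip_GL])
    show "\<forall>x\<in>GL n - unip n. w x * w' x * delta eta (row_mult eta x) = 0"
    proof
      fix x :: "'k mat" assume x: "x \<in> GL n - unip n"
      have xc: "x \<in> carrier_mat n n" using x GL_carrier by blast
      show "w x * w' x * delta eta (row_mult eta x) = 0"
      proof (cases "row_mult eta x = eta")
        case True
        hence "row x (n - 1) = eta" using row_mult_unit[OF n_pos xc] by simp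
        hence row: "row x (n - 1) $ j = eta $ j" for j by simp
        have r: "x $$ (n - 1, j) = (if n - 1 = j then 1 else 0)" if "j < n" for j
        proof -
          have "x $$ (n - 1, j) = row x (n - 1) $ j" using that n_pos xc by simp
          also have "\<dots> = (if n - 1 = j then 1 else 0)"
            unfolding row using that n_pos by (simp add: unit_vec_def)
          finally show ?thesis .
        qed
        have "w x = 0"
        proof (rule ccontr)
          assume "w x \<noteq> 0"
          hence "x \<in> unip n"
          proof (intro W.whittaker_vector_support[OF w(1,2), of "n - 1"])
            fix i j assume "i < n" "j < n" "n - 1 \<le> i"
            moreover from this have "i = n - 1" by simp
            ultimately show "x $$ (i, j) = (if i = j then 1 else 0)" using r by simp
          qed (use x n_pos in auto)
          thus False using x by simp
        qed
        thus ?thesis by simp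
      qed (simp add: delta_def)
    qed
    show "w x * w' x * delta eta (row_mult eta x) = 1" if x: "x \<in> unip n" for x
      using W.W_equivariant[OF w(1) x GL_one] W'.W_equivariant[OF w'(1) x GL_one] w(3) w'(2)
        unip_carrier[OF x] row_mult_eta_unip[OF x]
      by (simp add: delta_def)
  qed
  finally show "of_nat (card (unip n :: 'k mat set)) * zeta_integral n w w' (delta eta)
    = of_nat (card (unip n :: 'k mat set)) * 1" by simp
qed

text \<open>\<open>GL n\<close> has two orbits on row vectors. The nonzero one reduces to
  \<open>eta\<close>, whose stabiliser is the mirabolic subgroup; the zero vector is fixed by
  everything and needs the case \<open>t = n\<close> of non-exceptionality.\<close>

lemma inv_trilinear_vanishes:
  assumes T: "inv_trilinear n W W' T" and exc: "\<not> exceptional_pair n psi W W'"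
    and span: "\<And>w. w \<in> W \<Longrightarrow> whittaker_vector psi n 1 w \<Longrightarrow> \<exists>r. w = fscale r w1"
      "\<And>w'. w' \<in> W' \<Longrightarrow> whittaker_vector (\<lambda>a. psi (- a)) n 1 w' \<Longrightarrow> \<exists>r. w' = fscale r w1'"
    and w1: "w1 \<in> W" "w1' \<in> W'" "T w1 w1' (delta eta) = 0"
    and w: "w \<in> W" "w' \<in> W'" "f \<in> Cfun n"
  shows "T w w' f = 0"
proof -
  have bil: "bilinear_on W W' (\<lambda>w w'. T w w' (delta x))" if "x \<in> carrier_vec n" for x
    using T delta_Cfun[OF that, where 'b='r] unfolding inv_trilinear_def bilinear_on_def by simp
  have inv: "T (rtrans n g w) (rtrans n g w') (delta x) = T w w' (delta (row_mult x g))"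
    if "g \<in> GL n" "w \<in> W" "w' \<in> W'" "x \<in> carrier_vec n" for g w w' x
    using T that Cact_delta[OF that(1,4), where 'b='r] delta_Cfun[OF row_mult_carrier[OF GL_carrier[OF that(1)]]]
    unfolding inv_trilinear_def by metis
  have eta_c: "eta \<in> carrier_vec n" by simp
  interpret P: mirabolic_form psi n W W' "\<lambda>w w'. T w w' (delta eta)"
  proof
    fix g :: "'k mat" and w w'
    assume g: "g \<in> GL n" "\<And>j. j < n \<Longrightarrow> g $$ (n - 1, j) = (if j = n - 1 then 1 else 0)"
      and w: "w \<in> W" "w' \<in> W'"
    have "row_mult eta g = eta"
      unfolding row_mult_unit[OF n_pos GL_carrier[OF g(1)]]
      using g(2) GL_carrier[OF g(1)] n_pos by (auto intro!: eq_vecI)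
    thus "T (rtrans n g w) (rtrans n g w') (delta eta) = T w w' (delta eta)"
      using inv[OF g(1) w eta_c] by simp
  qed (use exc bil[OF eta_c] in auto)
  have eta0: "T w w' (delta eta) = 0" if w: "w \<in> W" "w' \<in> W'" for w w'
  proof (rule P.B_vanishes[OF n_pos _ w])
    fix w w' assume "w \<in> W" "w' \<in> W'" "whittaker_vector psi n 1 w" "whittaker_vector (\<lambda>a. psi (- a)) n 1 w'"
    then obtain r r' where "w = fscale r w1" "w' = fscale r' w1'" using span by metis
    thus "T w w' (delta eta) = 0"
      using w1 by (simp only: P.B_scale_left P.B_scale_right W'.W_scale mult_zero_right)
  qed
  \<comment> \<open>For \<open>t = n\<close> the derivative has order 0 and no relations, so the
    submodule to be killed is just the span of the empty set.\<close>
  have zero0: "T w w' (delta (0\<^sub>v n)) = 0"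
  proof (rule not_exceptional_form_0[OF exc _ _ _ _ _ w(1,2), where t = n])
    show "n \<in> {1..n}" using n_pos by simp
    show b: "bilinear_on W W' (\<lambda>w w'. T w w' (delta (0\<^sub>v n)))" by (rule bil) simp
    have z: "T 0 w' (delta (0\<^sub>v n)) = 0" "T w 0 (delta (0\<^sub>v n)) = 0" if "w \<in> W" "w' \<in> W'" for w w'
      using b that W.W_0 W'.W_0 unfolding bilinear_on_def by (metis rt.scale_zero_left mult_zero_left)+
    show "T w w' (delta (0\<^sub>v n)) = 0"
      if "w \<in> W" "w \<in> deriv_sub fscale (rtrans n) psi n (n - n) W" "w' \<in> W'" for w w'
      using that z by (auto simp: deriv_sub_def deriv_gens_def)
    show "T w w' (delta (0\<^sub>v n)) = 0"
      if "w \<in> W" "w' \<in> W'" "w' \<in> deriv_sub fscale (rtrans n) (\<lambda>a. psi (- a)) n (n - n) W'" for w w'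
      using that z by (auto simp: deriv_sub_def deriv_gens_def)
    fix g :: "'k mat" and w w' assume g: "g \<in> GL n" and w: "w \<in> W" "w' \<in> W'"
    show "T (rtrans n (embG n n g) w) (rtrans n (embG n n g) w') (delta (0\<^sub>v n)) = T w w' (delta (0\<^sub>v n))"
      unfolding embG_self[OF GL_carrier[OF g]]
      using inv[OF g w, of "0\<^sub>v n"] row_mult_zero[OF GL_carrier[OF g]] by simp
  qed
  have delta0: "T w w' (delta x) = 0" if x: "x \<in> carrier_vec n" for x
  proof (cases "x = 0\<^sub>v n")
    case False
    then obtain j where j: "j < n" "x $ j \<noteq> 0" using x by (metis carrier_vecD eq_vecI index_zero_vec)
    obtain g where g: "g \<in> GL n" "\<And>j. j < n \<Longrightarrow> g $$ (n - 1, j) = x $ j"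
      using GL_with_last_row[of j n "\<lambda>j. x $ j"] j by blast
    have "row_mult eta g = x"
      unfolding row_mult_unit[OF n_pos GL_carrier[OF g(1)]]
      using g(2) GL_carrier[OF g(1)] n_pos x by (auto intro!: eq_vecI)
    hence "T w w' (delta x) = T (rtrans n g w) (rtrans n g w') (delta eta)"
      using inv[OF g(1) w(1,2) eta_c] by simp
    thus ?thesis using eta0 W.W_rtrans[OF g(1) w(1)] W'.W_rtrans[OF g(1) w(2)] by simp
  qed (use zero0 in simp)
  have T_add: "T w w' (f1 + f2) = T w w' f1 + T w w' f2" if "f1 \<in> Cfun n" "f2 \<in> Cfun n" for f1 f2
    using T w that unfolding inv_trilinear_def by blast
  have T_scale: "T w w' (fscale r f) = r * T w w' f" if "f \<in> Cfun n" for r f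
    using T w that unfolding inv_trilinear_def by blast
  \<comment> \<open>Membership in \<open>Cfun n\<close> is carried along because \<open>T\<close> is
    only known to be additive there.\<close>
  have "(\<Sum>x\<in>I. fscale (f x) (delta x)) \<in> Cfun n \<and> T w w' (\<Sum>x\<in>I. fscale (f x) (delta x)) = 0"
    if "finite I" "I \<subseteq> carrier_vec n" for I
    using that
  proof (induction I rule: finite_induct)
    case empty
    have "(0 :: 'k vec \<Rightarrow> 'r) \<in> Cfun n" by (simp add: Cfun_def)
    thus ?case using T_scale[of 0 0] by (auto simp: fscale_def zero_fun_def)
  next
    case (insert x I)
    let ?g = "fscale (f x) (delta x)" and ?h = "\<Sum>x\<in>I. fscale (f x) (delta x)"
    have x: "x \<in> carrier_vec n" and h: "?h \<in> Cfun n" "T w w' ?h = 0" using insert by auto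
    have g: "?g \<in> Cfun n" using x by (auto simp: Cfun_def fscale_def delta_def)
    have "T w w' (?g + ?h) = 0"
      by (simp only: T_add[OF g h(1)] T_scale[OF delta_Cfun[OF x]] delta0[OF x] h(2) mult_zero_right add_0)
    moreover have "?g + ?h \<in> Cfun n" using g h(1) by (simp add: Cfun_def)
    ultimately show ?case by (simp only: sum.insert[OF insert.hyps])
  qed
  from this[OF finite_carrier_vec order_refl] show ?thesis using Cfun_expand[OF w(3)] by simp
qed

lemma inv_trilinear_diff:
  assumes S: "inv_trilinear n W W' S" and T: "inv_trilinear n W W' T"
  shows "inv_trilinear n W W' (\<lambda>w w' f. S w w' f - r * T w w' f)"
  using S T unfolding inv_trilinear_def by (simp add: algebra_simps)

text \<open>The zeta integral is 1 at \<open>w1\<close>, \<open>w1'\<close> and the indicator of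
  \<open>eta\<close>, so the scalar must be the value of \<open>T\<close> at that point. Subtracting
  this multiple leaves a form to which \<open>inv_trilinear_vanishes\<close> applies.\<close>

theorem inv_trilinear_unique:
  assumes exc: "\<not> exceptional_pair n psi W W'"
    and w1: "w1 \<in> W" "whittaker_vector psi n 1 w1" "w1 (1\<^sub>m n) = 1" "w1' \<in> W'" "w1' (1\<^sub>m n) = 1"
    and span: "\<And>w. w \<in> W \<Longrightarrow> whittaker_vector psi n 1 w \<Longrightarrow> \<exists>r. w = fscale r w1"
      "\<And>w'. w' \<in> W' \<Longrightarrow> whittaker_vector (\<lambda>a. psi (- a)) n 1 w' \<Longrightarrow> \<exists>r. w' = fscale r w1'"
    and T: "inv_trilinear n W W' T"
  shows "\<exists>!r. \<forall>w\<in>W. \<forall>w'\<in>W'. \<forall>f\<in>Cfun n. T w w' f = r * zeta_integral n w w' f"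
proof (rule ex1I[of _ "T w1 w1' (delta eta)"])
  have z: "zeta_integral n w1 w1' (delta eta) = 1" by (rule zeta_integral_whittaker_vectors[OF w1])
  let ?S = "\<lambda>w w' f. T w w' f - T w1 w1' (delta eta) * zeta_integral n w w' f"
  have "?S w w' f = 0" if "w \<in> W" "w' \<in> W'" "f \<in> Cfun n" for w w' f
    by (rule inv_trilinear_vanishes[OF inv_trilinear_diff[OF T inv_trilinear_zeta_integral] exc span w1(1,4) _ that])
      (simp_all only: z mult_1_right diff_self)
  thus "\<forall>w\<in>W. \<forall>w'\<in>W'. \<forall>f\<in>Cfun n. T w w' f = T w1 w1' (delta eta) * zeta_integral n w w' f" by simp
  fix r assume "\<forall>w\<in>W. \<forall>w'\<in>W'. \<forall>f\<in>Cfun n. T w w' f = r * zeta_integral n w w' f"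
  hence "T w1 w1' (delta eta) = r * zeta_integral n w1 w1' (delta eta)"
    using w1(1,4) delta_Cfun[OF unit_vec_carrier] by blast
  thus "r = T w1 w1' (delta eta)" by (simp only: z mult_1_right)
qed

end

text \<open>Existence of \<open>r\<close> says that the zeta integral generates the module of forms;
  uniqueness, applied to the zero form, says that no nonzero scalar annihilates it.\<close>

theorem theorem3p13:
  fixes n :: nat
    and zeta :: "'r::comm_ring_1"
    and chi :: "'k::{field,finite} \<Rightarrow> nat"
    and sc :: "'r \<Rightarrow> 'v::ab_group_add \<Rightarrow> 'v" and act :: "'k mat \<Rightarrow> 'v \<Rightarrow> 'v"
    and sc' :: "'r \<Rightarrow> 'u::ab_group_add \<Rightarrow> 'u" and act' :: "'k mat \<Rightarrow> 'u \<Rightarrow> 'u"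
    and l :: "'v \<Rightarrow> 'r" and l' :: "'u \<Rightarrow> 'r"
  assumes R_nontriv: "(0::'r) \<noteq> 1"
    and R_noeth: "noetherian_ring TYPE('r)"
    and R_alg: "zp_algebra CHAR('k) zeta"
    and psi_nontriv: "nontriv_additive_modp CHAR('k) chi"
    and n_pos: "1 \<le> n"
    and V_rep: "is_rep sc act n" and V'_rep: "is_rep sc' act' n"
    and V_wt: "whittaker_type sc act (psiR zeta chi) n"
    and V'_wt: "whittaker_type sc' act' (\<lambda>a. psiR zeta chi (- a)) n"
    and l_gen: "whittaker_generator sc act (psiR zeta chi) n l"
    and l'_gen: "whittaker_generator sc' act' (\<lambda>a. psiR zeta chi (- a)) n l'"
    and not_exc: "\<not> exceptional_pair n (psiR zeta chi)
                     (whittaker_model act n l) (whittaker_model act' n l')"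
  shows "inv_trilinear n (whittaker_model act n l) (whittaker_model act' n l') (zeta_integral n)
       \<and> (\<forall>T. inv_trilinear n (whittaker_model act n l) (whittaker_model act' n l') T \<longrightarrow>
            (\<exists>!r. \<forall>w\<in>whittaker_model act n l. \<forall>w'\<in>whittaker_model act' n l'. \<forall>\<Phi>\<in>Cfun n.
                   T w w' \<Phi> = r * zeta_integral n w w' \<Phi>))"
proof -
  interpret additive_character "psiR zeta chi"
    by (rule additive_character_psiR[OF R_alg psi_nontriv])
  interpret V: whittaker_module "psiR zeta chi" n sc act l
    by unfold_locales (fact V_rep V_wt l_gen)+
  interpret V': whittaker_module "\<lambda>a. psiR zeta chi (- a)" n sc' act' l'
    by (intro whittaker_module.intro whittaker_module_axioms.intro additive_character_minus
        V'_rep V'_wt l'_gen)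
  interpret whittaker_pair "psiR zeta chi" n "range V.model" "range V'.model"
    by unfold_locales (fact n_pos)
  obtain w1 where w1: "w1 \<in> range V.model" "whittaker_vector (psiR zeta chi) n 1 w1" "w1 (1\<^sub>m n) = 1"
    and s1: "\<forall>w\<in>range V.model. whittaker_vector (psiR zeta chi) n 1 w \<longrightarrow> (\<exists>r. w = fscale r w1)"
    using V.obtain_whittaker_vector .
  obtain w1' where w1': "w1' \<in> range V'.model" "whittaker_vector (\<lambda>a. psiR zeta chi (- a)) n 1 w1'" "w1' (1\<^sub>m n) = 1"
    and s1': "\<forall>w\<in>range V'.model. whittaker_vector (\<lambda>a. psiR zeta chi (- a)) n 1 w \<longrightarrow> (\<exists>r. w = fscale r w1')"
    using V'.obtain_whittaker_vector .
  show ?thesis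
    unfolding V.whittaker_model_eq V'.whittaker_model_eq
    using inv_trilinear_zeta_integral
      inv_trilinear_unique[OF not_exc[unfolded V.whittaker_model_eq V'.whittaker_model_eq] w1 w1'(1,3) s1[rule_format] s1'[rule_format]]
    by (intro conjI allI impI)
qed

end
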